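(* Let $X$ be a locally separable metrizable space. Then $C_s(X)$, with pointwise operations and the supremum norm, is a Banach algebra, and it is isometrically isomorphic (as a Banach algebra) to the Banach algebra $C_0(Y)$ for some locally compact Hausdorff space $Y$, which is unique up to homeomorphism (among locally compact Hausdorff spaces). The space $Y$ is countably compact, and if $X$ is non-separable, then $Y$ is non-normal. Furthermore, $C_0(Y)=C_{00}(Y)$.
   Context: All spaces are Hausdorff. The field of scalars $\mathbb{F}$ is fixed and is either $\mathbb{R}$ or $\mathbb{C}$ (the result is asserted for each choice). A Banach algebra is not required to have a unit. For a space $X$, $C_b(X)$ is the algebra of all continuous bounded functions $X\to\mathbb{F}$ with pointwise operations and the supremum norm. For $f\in C_b(X)$, $\mathrm{Coz}(f)=\{x\in X: f(x)\neq 0\}$ and $\mathrm{supp}(f)=\mathrm{cl}_X\,\mathrm{Coz}(f)$. For a metrizable space $X$, $C_s(X)=\{f\in C_b(X):\mathrm{supp}(f)\text{ is separable}\}$. For a space $Y$, $C_0(Y)$ is the set of all $f\in C_b(Y)$ such that $|f|^{-1}([\epsilon,\infty))$ is compact for each $\epsilon>0$, and $C_{00}(Y)$ is the set of all $f\in C_b(Y)$ with compact support. A space is locally separable if each of its points has a separable open neighborhood. A space is countably compact if every countable open cover has a finite subcover. *)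

theory Defs
  imports "HOL-Analysis.Analysis"
begin

section \<open>Topological notions for abstract topologies\<close>

definition locally_separable_space :: "'a topology \<Rightarrow> bool" where
  "locally_separable_space X \<longleftrightarrow>
     (\<forall>x\<in>topspace X. \<exists>U. openin X U \<and> x \<in> U \<and> separable_space (subtopology X U))"

text \<open>The library only has \<^const>\<open>countably_compact\<close> for sets in a type-class topology.\<close>

definition countably_compact_space :: "'a topology \<Rightarrow> bool" where
  "countably_compact_space X \<longleftrightarrow>
     (\<forall>\<U>. countable \<U> \<and> (\<forall>U\<in>\<U>. openin X U) \<and> topspace X \<subseteq> \<Union>\<U>
        \<longrightarrow> (\<exists>\<F>. finite \<F> \<and> \<F> \<subseteq> \<U> \<and> topspace X \<subseteq> \<Union>\<F>))"

section \<open>Banach algebras, not necessarily unital\<close>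

text \<open>The scalar field \<open>'k\<close> is meant to be \<^typ>\<open>real\<close> or \<^typ>\<open>complex\<close>. The algebra is
  carried by a set rather than by a type, since the function algebras below depend on a topology
  given as a value.\<close>

record ('k, 'v) normed_alg =
  carr :: "'v set"
  zero :: 'v
  add :: "'v \<Rightarrow> 'v \<Rightarrow> 'v"
  mult :: "'v \<Rightarrow> 'v \<Rightarrow> 'v"
  scale :: "'k \<Rightarrow> 'v \<Rightarrow> 'v"
  nrm :: "'v \<Rightarrow> real"

definition diff :: "('k::real_normed_field, 'v) normed_alg \<Rightarrow> 'v \<Rightarrow> 'v \<Rightarrow> 'v" where
  "diff A x y = add A x (scale A (- 1) y)"

locale banach_algebra =
  fixes A :: "('k::real_normed_field, 'v) normed_alg"
  assumes zero_closed: "zero A \<in> carr A"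
    and add_closed: "\<lbrakk>x \<in> carr A; y \<in> carr A\<rbrakk> \<Longrightarrow> add A x y \<in> carr A"
    and mult_closed: "\<lbrakk>x \<in> carr A; y \<in> carr A\<rbrakk> \<Longrightarrow> mult A x y \<in> carr A"
    and scale_closed: "x \<in> carr A \<Longrightarrow> scale A c x \<in> carr A"
    and add_assoc: "\<lbrakk>x \<in> carr A; y \<in> carr A; z \<in> carr A\<rbrakk>
          \<Longrightarrow> add A (add A x y) z = add A x (add A y z)"
    and add_commute: "\<lbrakk>x \<in> carr A; y \<in> carr A\<rbrakk> \<Longrightarrow> add A x y = add A y x"
    and add_zero: "x \<in> carr A \<Longrightarrow> add A x (zero A) = x"
    and add_inverse: "x \<in> carr A \<Longrightarrow> \<exists>y\<in>carr A. add A x y = zero A"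
    and scale_add_right: "\<lbrakk>x \<in> carr A; y \<in> carr A\<rbrakk>
          \<Longrightarrow> scale A c (add A x y) = add A (scale A c x) (scale A c y)"
    and scale_add_left: "x \<in> carr A \<Longrightarrow> scale A (c + d) x = add A (scale A c x) (scale A d x)"
    and scale_scale: "x \<in> carr A \<Longrightarrow> scale A c (scale A d x) = scale A (c * d) x"
    and scale_one: "x \<in> carr A \<Longrightarrow> scale A 1 x = x"
    and mult_assoc: "\<lbrakk>x \<in> carr A; y \<in> carr A; z \<in> carr A\<rbrakk>
          \<Longrightarrow> mult A (mult A x y) z = mult A x (mult A y z)"
    and mult_add_left: "\<lbrakk>x \<in> carr A; y \<in> carr A; z \<in> carr A\<rbrakk>
          \<Longrightarrow> mult A (add A x y) z = add A (mult A x z) (mult A y z)"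
    and mult_add_right: "\<lbrakk>x \<in> carr A; y \<in> carr A; z \<in> carr A\<rbrakk>
          \<Longrightarrow> mult A x (add A y z) = add A (mult A x y) (mult A x z)"
    and mult_scale_left: "\<lbrakk>x \<in> carr A; y \<in> carr A\<rbrakk>
          \<Longrightarrow> mult A (scale A c x) y = scale A c (mult A x y)"
    and mult_scale_right: "\<lbrakk>x \<in> carr A; y \<in> carr A\<rbrakk>
          \<Longrightarrow> mult A x (scale A c y) = scale A c (mult A x y)"
    and nrm_nonneg: "x \<in> carr A \<Longrightarrow> 0 \<le> nrm A x"
    and nrm_eq_0: "x \<in> carr A \<Longrightarrow> nrm A x = 0 \<longleftrightarrow> x = zero A"
    and nrm_triangle: "\<lbrakk>x \<in> carr A; y \<in> carr A\<rbrakk> \<Longrightarrow> nrm A (add A x y) \<le> nrm A x + nrm A y"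
    and nrm_scale: "x \<in> carr A \<Longrightarrow> nrm A (scale A c x) = norm c * nrm A x"
    and nrm_mult: "\<lbrakk>x \<in> carr A; y \<in> carr A\<rbrakk> \<Longrightarrow> nrm A (mult A x y) \<le> nrm A x * nrm A y"
    and complete:
      "\<lbrakk>\<And>n. s n \<in> carr A;
        \<And>e. 0 < e \<Longrightarrow> \<exists>N. \<forall>m\<ge>N. \<forall>n\<ge>N. nrm A (diff A (s m) (s n)) < e\<rbrakk>
       \<Longrightarrow> \<exists>l\<in>carr A. (\<lambda>n. nrm A (diff A (s n) l)) \<longlonglongrightarrow> 0"

definition isometrically_isomorphic ::
    "('k, 'v) normed_alg \<Rightarrow> ('k, 'w) normed_alg \<Rightarrow> bool" where
  "isometrically_isomorphic A B \<longleftrightarrow>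
     (\<exists>\<phi>. bij_betw \<phi> (carr A) (carr B) \<and>
          (\<forall>x\<in>carr A. \<forall>y\<in>carr A. \<phi> (add A x y) = add B (\<phi> x) (\<phi> y)) \<and>
          (\<forall>x\<in>carr A. \<forall>y\<in>carr A. \<phi> (mult A x y) = mult B (\<phi> x) (\<phi> y)) \<and>
          (\<forall>c. \<forall>x\<in>carr A. \<phi> (scale A c x) = scale B c (\<phi> x)) \<and>
          (\<forall>x\<in>carr A. nrm B (\<phi> x) = nrm A x))"

section \<open>Algebras of bounded continuous functions\<close>

text \<open>A function on the space \<open>X\<close> is represented by the total function that is \<open>0\<close> outside
  \<^term>\<open>topspace X\<close>; this makes the representation unique and is preserved by the pointwise
  operations.\<close>

definition C_b :: "'a topology \<Rightarrow> ('a \<Rightarrow> 'k::real_normed_field) set" where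
  "C_b X = {f. continuous_map X euclidean f \<and> bounded (f ` topspace X) \<and>
               (\<forall>x. x \<notin> topspace X \<longrightarrow> f x = 0)}"

definition Coz :: "'a topology \<Rightarrow> ('a \<Rightarrow> 'k::real_normed_field) \<Rightarrow> 'a set" where
  "Coz X f = {x \<in> topspace X. f x \<noteq> 0}"

definition supp :: "'a topology \<Rightarrow> ('a \<Rightarrow> 'k::real_normed_field) \<Rightarrow> 'a set" where
  "supp X f = X closure_of Coz X f"

definition C_s :: "'a topology \<Rightarrow> ('a \<Rightarrow> 'k::real_normed_field) set" where
  "C_s X = {f \<in> C_b X. separable_space (subtopology X (supp X f))}"

definition C_0 :: "'a topology \<Rightarrow> ('a \<Rightarrow> 'k::real_normed_field) set" where
  "C_0 Y = {f \<in> C_b Y. \<forall>\<epsilon>>0. compactin Y {y \<in> topspace Y. \<epsilon> \<le> norm (f y)}}"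

definition C_00 :: "'a topology \<Rightarrow> ('a \<Rightarrow> 'k::real_normed_field) set" where
  "C_00 Y = {f \<in> C_b Y. compactin Y (supp Y f)}"

text \<open>Inserting \<open>0\<close> does not affect the supremum of a nonempty set of norms; it gives the
  zero function on the empty space norm \<open>0\<close>.\<close>

definition sup_norm :: "'a topology \<Rightarrow> ('a \<Rightarrow> 'k::real_normed_field) \<Rightarrow> real" where
  "sup_norm X f = Sup (insert 0 ((\<lambda>x. norm (f x)) ` topspace X))"

definition fun_alg ::
    "'a topology \<Rightarrow> ('a \<Rightarrow> 'k::real_normed_field) set \<Rightarrow> ('k, 'a \<Rightarrow> 'k) normed_alg" where
  "fun_alg X F =
     \<lparr>carr = F, zero = (\<lambda>x. 0), add = (\<lambda>f g x. f x + g x), mult = (\<lambda>f g x. f x * g x),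
      scale = (\<lambda>c f x. c * f x), nrm = sup_norm X\<rparr>"

end

theory Submission
  imports Defs "HOL-Library.Countable_Set_Type"
begin

text \<open>
  A locally separable metrizable space \<open>X\<close> splits into disjoint open separable pieces
  (\<open>separable_partition\<close>), and a separable subset meets only countably many of them. Hence a bounded
  continuous function has separable support exactly when it vanishes off the union \<open>\<Union>C\<close> of a
  countable family \<open>C\<close> of pieces.

  Let \<open>B\<close> be the Stone-Cech compactification of \<open>X\<close>. The closure of the clopen set \<open>\<Union>C\<close> in \<open>B\<close> is
  clopen and compact, and the space \<open>Y\<close> of the theorem is the union of these closures over all
  countable \<open>C\<close>. It is open in \<open>B\<close>, so it is locally compact. The union over \<open>C\<close> is directed, even
  under countable unions: every countable subset and every compact subset of \<open>Y\<close> lies in one of the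
  compact closures. So \<open>Y\<close> is countably compact and functions in \<open>C_0 Y\<close> have compact support; such
  a function restricts along \<open>X \<rightarrow> Y\<close> to a function vanishing off some \<open>\<Union>C\<close>, and every function of
  this kind extends to \<open>B\<close> and then vanishes off the closure of \<open>\<Union>C\<close>. This gives the isometric
  isomorphism (\<open>C_countable_isomorphic_C_0_Y\<close>).

  For uniqueness, a contractive character of \<open>C_0 Y\<close> is evaluation at a point
  (\<open>C_0_character_is_evaluation\<close>). An algebra that is isometrically isomorphic to both \<open>C_0 Y\<close> and
  \<open>C_0 Z\<close> therefore identifies the points of \<open>Y\<close> with those of \<open>Z\<close>, and since functions vanishing at
  infinity determine the topology of a locally compact Hausdorff space, the identification is a
  homeomorphism.

  If \<open>X\<close> is not separable, there are uncountably many pieces, and some of them can be indexed by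
  \<open>\<omega>\<^sub>1 \<times> \<nat>\<close>. Take functions \<open>f\<^sub>a : {x. x \<le> a} \<rightarrow> \<nat>\<close> for \<open>a < \<omega>\<^sub>1\<close> which are finite-to-one and agree
  with each other up to finitely many points, as in the construction of an Aronszajn tree. The points
  of \<open>Y\<close> at infinity below the graph of some \<open>f\<^sub>a\<close>, and those on or above it, form two sets; coherence
  makes them closed and disjoint. Disjoint neighbourhoods would produce one function
  \<open>F : \<omega>\<^sub>1 \<rightarrow> \<nat>\<close> that agrees with each \<open>f\<^sub>a\<close> up to finitely many points. Such an \<open>F\<close> would have an
  infinite fibre on some \<open>{x. x \<le> a}\<close>, so \<open>f\<^sub>a\<close> would not be finite-to-one. Hence \<open>Y\<close> is not normal
  (\<open>not_normal_Y\<close>).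

  The scalars are a type in \<open>real_normed_field\<close> and \<open>euclidean_space\<close>, which covers both fields: the
  Euclidean structure reduces extension of bounded functions to real coordinates, and the field
  structure supplies \<open>z\<inverse> * \<bar>z\<bar>\<^sup>2\<close> in the role of the complex conjugate.
\<close>

section \<open>Separable subsets of metrizable spaces\<close>

text \<open>Separability of \<open>A\<close> with the countable set taken anywhere in \<open>X\<close>. In this form it passes trivially
to subsets, and in a metrizable space it agrees with separability of the subspace.\<close>

definition separable_in :: "'a topology \<Rightarrow> 'a set \<Rightarrow> bool" where
  "separable_in X A \<longleftrightarrow> (\<exists>C. countable C \<and> C \<subseteq> topspace X \<and> A \<subseteq> X closure_of C)"

lemma separable_in_subset: "separable_in X A \<Longrightarrow> B \<subseteq> A \<Longrightarrow> separable_in X B"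
  unfolding separable_in_def by blast

lemma separable_in_closure: "separable_in X A \<Longrightarrow> separable_in X (X closure_of A)"
  unfolding separable_in_def by (meson closedin_closure_of closure_of_minimal)

lemma separable_in_countable_UN:
  assumes "countable I" "\<And>i. i \<in> I \<Longrightarrow> separable_in X (A i)"
  shows "separable_in X (\<Union>i\<in>I. A i)"
proof -
  obtain C where C: "\<And>i. i \<in> I \<Longrightarrow> countable (C i) \<and> C i \<subseteq> topspace X \<and> A i \<subseteq> X closure_of C i"
    using assms(2) unfolding separable_in_def by metis
  have "A i \<subseteq> X closure_of (\<Union>i\<in>I. C i)" if "i \<in> I" for i
    using C[OF that] closure_of_mono[of "C i" "\<Union>i\<in>I. C i" X] that by blast
  then show ?thesis
    unfolding separable_in_def using C assms(1)
    by (intro exI[of _ "\<Union>i\<in>I. C i"]) (auto intro!: countable_UN)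
qed

lemma separable_in_Un: "separable_in X A \<Longrightarrow> separable_in X B \<Longrightarrow> separable_in X (A \<union> B)"
  using separable_in_countable_UN[of "{A,B}" X "\<lambda>i. i"] by auto

text \<open>Given a countable set \<open>C\<close> whose closure contains \<open>A\<close>, pick a point of \<open>A\<close> in each ball of radius
\<open>1 / (n + 1)\<close> about a point of \<open>C\<close> that meets \<open>A\<close>. These points are dense in \<open>A\<close>.\<close>

lemma separable_space_subtopology_iff:
  assumes "metrizable_space X" and A: "A \<subseteq> topspace X"
  shows "separable_space (subtopology X A) \<longleftrightarrow> separable_in X A"
proof
  assume "separable_space (subtopology X A)"
  then obtain C where C: "countable C" "C \<subseteq> A" "subtopology X A closure_of C = A"
    unfolding separable_space_def topspace_subtopology_subset[OF A] by blast
  then have "A \<subseteq> X closure_of C"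
    by (metis closure_of_subtopology_subset)
  then show "separable_in X A"
    unfolding separable_in_def using C A by blast
next
  obtain M d where md: "Metric_space M d" "X = Metric_space.mtopology M d"
    using assms(1) unfolding metrizable_space_def by blast
  interpret Metric_space M d by (rule md)
  assume "separable_in X A"
  then obtain C where C: "countable C" "C \<subseteq> M" "A \<subseteq> mtopology closure_of C"
    unfolding separable_in_def by (auto simp: md)
  define p where "p = (\<lambda>(c,n). SOME a. a \<in> A \<inter> mball c (inverse (real (Suc n))))"
  define S where "S = p ` {(c,n). c \<in> C \<and> A \<inter> mball c (inverse (real (Suc n))) \<noteq> {}}"
  have p: "p (c,n) \<in> A \<inter> mball c (inverse (real (Suc n)))"
    if "A \<inter> mball c (inverse (real (Suc n))) \<noteq> {}" for c n
    unfolding p_def case_prod_conv using someI_ex[of "\<lambda>a. a \<in> A \<inter> mball c (inverse (real (Suc n)))"] that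
    by blast
  have "countable S"
    unfolding S_def
    by (rule countable_image, rule countable_subset[of _ "C \<times> UNIV"]) (use C in auto)
  moreover have "S \<subseteq> A"
    unfolding S_def using p by auto
  moreover have "A \<subseteq> mtopology closure_of S"
  proof
    fix a assume a: "a \<in> A"
    have "\<exists>y\<in>S. y \<in> mball a r" if r: "r > 0" for r
    proof -
      obtain n where n: "inverse (real (Suc n)) < r/2"
        using reals_Archimedean[of "r/2"] r by auto
      obtain c where c: "c \<in> C" "c \<in> mball a (inverse (real (Suc n)))"
      proof -
        have "a \<in> mtopology closure_of C" using C a by blast
        moreover have "0 < inverse (real (Suc n))" by simp
        ultimately show thesis using that unfolding metric_closure_of by blast
      qed
      have "a \<in> A \<inter> mball c (inverse (real (Suc n)))"
        using a c commute[of a c] by auto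
      then have ne: "A \<inter> mball c (inverse (real (Suc n))) \<noteq> {}" by blast
      have "p (c,n) \<in> S"
        unfolding S_def using c ne by auto
      moreover have "d a (p (c,n)) \<le> d a c + d c (p (c,n))"
        using p[OF ne] c by (intro triangle) auto
      then have "p (c,n) \<in> mball a r"
        using p[OF ne] c n by auto
      ultimately show ?thesis by blast
    qed
    then show "a \<in> mtopology closure_of S"
      unfolding metric_closure_of using a A by (auto simp: md)
  qed
  ultimately show "separable_space (subtopology X A)"
    unfolding separable_space_def using A
    by (intro exI[of _ S]) (auto simp: closure_of_subtopology md Int_absorb1 topspace_subtopology_subset)
qed

text \<open>Relate two points at distance less than some \<open>r\<close> when the balls of radius \<open>4 r\<close> about both are
separable. The pieces are the classes of the generated equivalence relation. They are open by local
separability. They are separable because a single step \<open>R `` A\<close> from a separable set is covered by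
the separable balls with rational radius and centre in a fixed countable set.\<close>

lemma separable_partition:
  assumes "metrizable_space X" and "locally_separable_space X"
  obtains \<P> where "\<Union>\<P> = topspace X" "disjoint \<P>"
    "\<And>U. U \<in> \<P> \<Longrightarrow> openin X U \<and> U \<noteq> {} \<and> separable_in X U"
proof -
  obtain M d where md: "Metric_space M d" "X = Metric_space.mtopology M d"
    using assms(1) unfolding metrizable_space_def by blast
  interpret Metric_space M d by (rule md)
  define R where "R = {(x,y). x \<in> M \<and> y \<in> M \<and> (\<exists>r>0. d x y < r \<and>
      separable_in X (mball x (4*r)) \<and> separable_in X (mball y (4*r)))}"
  have symR: "sym R"
    unfolding R_def sym_def by (auto simp: commute)
  have RM: "R \<subseteq> M \<times> M"
    unfolding R_def by auto
  have small: "\<exists>r>0. separable_in X (mball x (8*r))" if "x \<in> M" for x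
  proof -
    obtain U where U: "openin X U" "x \<in> U" "separable_space (subtopology X U)"
      using assms(2) \<open>x \<in> M\<close> unfolding locally_separable_space_def by (auto simp: md)
    then have "separable_in X U"
      using separable_space_subtopology_iff[OF assms(1)] openin_subset by blast
    moreover obtain r where "r > 0" "mball x r \<subseteq> U"
      using U unfolding md openin_mtopology by auto
    ultimately show ?thesis
      by (intro exI[of _ "r/8"]) (auto intro: separable_in_subset)
  qed
  have step: "separable_in X (R `` A)" if A: "separable_in X A" for A
  proof -
    obtain C where C: "countable C" "C \<subseteq> M" "A \<subseteq> mtopology closure_of C"
      using A unfolding separable_in_def by (auto simp: md)
    define I where "I = {(c,q). c \<in> C \<and> q \<in> \<rat> \<and> separable_in X (mball c q)}"
    have "countable I"
      unfolding I_def
      by (rule countable_subset[of _ "C \<times> \<rat>"]) (use C in \<open>auto simp: countable_rat\<close>)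
    then have "separable_in X (\<Union>(c,q)\<in>I. mball c q)"
      by (rule separable_in_countable_UN) (auto simp: I_def)
    moreover have "R `` A \<subseteq> (\<Union>(c,q)\<in>I. mball c q)"
    proof
      fix y assume "y \<in> R `` A"
      then obtain x r where x: "x \<in> A" "x \<in> M" "y \<in> M" "r > 0" "d x y < r"
        "separable_in X (mball x (4*r))"
        unfolding R_def by auto
      \<comment> \<open>The ball about \<open>c\<close> of radius \<open>q\<close> must reach \<open>y\<close>, at distance less than \<open>2 r\<close> from \<open>c\<close>, and stay
        inside the separable ball of radius \<open>4 r\<close> about \<open>x\<close>.\<close>
      obtain q where q: "q \<in> \<rat>" "2*r < q" "q < 3*r"
        using Rats_dense_in_real[of "2*r" "3*r"] x by auto
      obtain c where c: "c \<in> C" "c \<in> mball x r"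
        using C x unfolding metric_closure_of by fastforce
      have "mball c q \<subseteq> mball x (4*r)"
        using c q commute[of x c] by (intro mball_subset) auto
      then have "(c,q) \<in> I"
        unfolding I_def using c q x separable_in_subset by auto
      moreover have "y \<in> mball c q"
        using triangle[of c x y] c q x by (auto simp: commute)
      ultimately show "y \<in> (\<Union>(c,q)\<in>I. mball c q)" by blast
    qed
    ultimately show ?thesis by (rule separable_in_subset)
  qed
  define K where "K = (\<lambda>x. R\<^sup>* `` {x})"
  have KM: "K x \<subseteq> M" if "x \<in> M" for x
  proof
    fix y assume "y \<in> K x"
    then have "(x,y) \<in> R\<^sup>*" unfolding K_def by auto
    then show "y \<in> M" using that by (induction rule: rtrancl_induct) (use RM in auto)
  qed
  have self: "x \<in> K x" for x unfolding K_def by auto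
  have eq: "K y = K x" if "y \<in> K x" for x y
  proof -
    have "(x,y) \<in> R\<^sup>*" "(y,x) \<in> R\<^sup>*"
      using that sym_rtrancl[OF symR] unfolding K_def by (auto dest: symD)
    then show ?thesis unfolding K_def by (auto intro: rtrancl_trans)
  qed
  have op: "openin X (K x)" if "x \<in> M" for x
    unfolding md openin_mtopology
  proof (intro conjI allI impI)
    fix y assume y: "y \<in> K x"
    have yM: "y \<in> M" using KM that y by blast
    obtain r where r: "r > 0" "separable_in X (mball y (8*r))" using small[OF yM] by blast
    \<comment> \<open>Radius \<open>8 r\<close> at \<open>y\<close> leaves room for the ball of radius \<open>4 r\<close> about each point near \<open>y\<close>.\<close>
    have "mball y r \<subseteq> K y"
    proof
      fix z assume z: "z \<in> mball y r"
      have "mball z (4*r) \<subseteq> mball y (8*r)" "mball y (4*r) \<subseteq> mball y (8*r)"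
        using z r commute[of y z] by (intro mball_subset; auto)+
      then have "separable_in X (mball z (4*r))" "separable_in X (mball y (4*r))"
        using separable_in_subset[OF r(2)] by blast+
      then have "(y,z) \<in> R"
        unfolding R_def using z r(1) by auto
      then show "z \<in> K y" unfolding K_def by auto
    qed
    then show "\<exists>r>0. mball y r \<subseteq> K x" using r eq[OF y] by auto
  qed (use KM[OF that] in auto)
  have sep: "separable_in X (K x)" if "x \<in> M" for x
  proof -
    have "separable_in X ((R ^^ n) `` {x})" for n
    proof (induction n)
      case 0
      have "{x} \<subseteq> X closure_of {x}"
        by (rule closure_of_subset) (use that in \<open>auto simp: md\<close>)
      then have "separable_in X {x}"
        unfolding separable_in_def using that by (intro exI[of _ "{x}"]) (auto simp: md)
      then show ?case by simp
    next
      case (Suc n)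
      then show ?case using step by (simp add: relcomp_Image)
    qed
    then have "separable_in X (\<Union>n. (R ^^ n) `` {x})"
      using separable_in_countable_UN[of UNIV X "\<lambda>n. (R ^^ n) `` {x}"] by auto
    moreover have "K x = (\<Union>n. (R ^^ n) `` {x})"
      unfolding K_def by (auto simp: rtrancl_power)
    ultimately show ?thesis by simp
  qed
  show ?thesis
  proof (rule that[of "K ` M"])
    show "\<Union> (K ` M) = topspace X" using KM self by (auto simp: md)
    show "disjoint (K ` M)"
      unfolding disjoint_def using eq by blast
  qed (use op sep self in auto)
qed

lemma countable_partition_members_meeting_separable:
  assumes "disjoint \<P>" "\<And>U. U \<in> \<P> \<Longrightarrow> openin X U" "separable_in X A"
  shows "countable {U \<in> \<P>. U \<inter> A \<noteq> {}}"
proof -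
  obtain C where C: "countable C" "A \<subseteq> X closure_of C"
    using assms(3) unfolding separable_in_def by blast
  have "{U \<in> \<P>. U \<inter> A \<noteq> {}} \<subseteq> (\<lambda>c. THE U. U \<in> \<P> \<and> c \<in> U) ` C"
  proof
    fix U assume U: "U \<in> {U \<in> \<P>. U \<inter> A \<noteq> {}}"
    then obtain a where "a \<in> U" "a \<in> X closure_of C" using C by auto
    then obtain c where c: "c \<in> C" "c \<in> U"
      using assms(2) U unfolding in_closure_of by blast
    then have "(THE U. U \<in> \<P> \<and> c \<in> U) = U"
      using U assms(1) unfolding disjoint_def by (intro the_equality) auto
    then show "U \<in> (\<lambda>c. THE U. U \<in> \<P> \<and> c \<in> U) ` C" using c by blast
  qed
  then show ?thesis using C(1) by (meson countable_image countable_subset)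
qed

section \<open>Banach algebras of bounded continuous functions\<close>

lemma continuous_map_euclidean_iff_tendsto:
  "continuous_map X euclidean f \<longleftrightarrow> (\<forall>x\<in>topspace X. (f \<longlongrightarrow> f x) (atin X x))"
  by (simp add: continuous_map_atin)

lemma C_b_D:
  assumes "f \<in> C_b X"
  shows C_b_continuous: "continuous_map X euclidean f"
    and C_b_bounded: "bounded (f ` topspace X)"
    and C_b_outside: "x \<notin> topspace X \<Longrightarrow> f x = 0"
  using assms unfolding C_b_def by auto

lemma C_b_I:
  assumes "continuous_map X euclidean f" "\<And>x. x \<in> topspace X \<Longrightarrow> norm (f x) \<le> c"
    "\<And>x. x \<notin> topspace X \<Longrightarrow> f x = 0"
  shows "f \<in> C_b X"
  using assms unfolding C_b_def bounded_iff by auto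

text \<open>Outside the space \<open>f\<close> is \<open>0\<close>, so the bound holds at every \<open>x\<close>.\<close>

lemma norm_le_sup_norm:
  assumes "f \<in> C_b X"
  shows "norm (f x) \<le> sup_norm X f"
proof -
  obtain c where "\<And>x. x \<in> topspace X \<Longrightarrow> norm (f x) \<le> c"
    using C_b_bounded[OF assms] unfolding bounded_iff by auto
  then have bdd: "bdd_above (insert 0 ((\<lambda>x. norm (f x)) ` topspace X))"
    unfolding bdd_above_insert by (rule bdd_aboveI2)
  have "norm (f x) \<in> insert 0 ((\<lambda>x. norm (f x)) ` topspace X)"
    using C_b_outside[OF assms, of x] by auto
  then show ?thesis
    unfolding sup_norm_def using bdd by (rule cSup_upper)
qed

lemma sup_norm_nonneg: "f \<in> C_b X \<Longrightarrow> 0 \<le> sup_norm X f"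
  using norm_le_sup_norm[of f X] norm_ge_zero order_trans by blast

lemma sup_norm_le:
  assumes "0 \<le> c" "\<And>x. x \<in> topspace X \<Longrightarrow> norm (f x) \<le> c"
  shows "sup_norm X f \<le> c"
  unfolding sup_norm_def using assms by (intro cSup_least) auto

lemma C_b_zero: "(\<lambda>x. 0) \<in> C_b X"
  by (rule C_b_I[where c=0]) auto

lemma C_b_add:
  assumes "f \<in> C_b X" "g \<in> C_b X"
  shows "(\<lambda>x. f x + g x) \<in> C_b X"
proof (rule C_b_I)
  show "continuous_map X euclidean (\<lambda>x. f x + g x)"
    using assms[THEN C_b_continuous] unfolding continuous_map_euclidean_iff_tendsto
    by (auto intro!: tendsto_add)
  show "norm (f x + g x) \<le> sup_norm X f + sup_norm X g" for x
    using assms[THEN norm_le_sup_norm, of x] norm_triangle_ineq[of "f x" "g x"] by linarith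
qed (use assms[THEN C_b_outside] in auto)

lemma C_b_mult:
  assumes "f \<in> C_b X" "g \<in> C_b X"
  shows "(\<lambda>x. f x * g x) \<in> C_b X"
proof (rule C_b_I)
  show "continuous_map X euclidean (\<lambda>x. f x * g x)"
    using assms[THEN C_b_continuous] unfolding continuous_map_euclidean_iff_tendsto
    by (auto intro!: tendsto_mult)
  show "norm (f x * g x) \<le> sup_norm X f * sup_norm X g" for x
    unfolding norm_mult using assms[THEN norm_le_sup_norm, of x] sup_norm_nonneg[OF assms(1)]
    by (intro mult_mono) auto
qed (use assms[THEN C_b_outside] in auto)

lemma C_b_scale:
  assumes "f \<in> C_b X"
  shows "(\<lambda>x. c * f x) \<in> C_b X"
proof (rule C_b_I)
  show "continuous_map X euclidean (\<lambda>x. c * f x)"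
    using assms[THEN C_b_continuous] unfolding continuous_map_euclidean_iff_tendsto
    by (auto intro!: tendsto_mult)
  show "norm (c * f x) \<le> norm c * sup_norm X f" for x
    unfolding norm_mult using assms[THEN norm_le_sup_norm, of x] by (intro mult_left_mono) auto
qed (use assms[THEN C_b_outside] in auto)

lemma C_b_diff:
  assumes "f \<in> C_b X" "g \<in> C_b X"
  shows "(\<lambda>x. f x - g x) \<in> C_b X"
  using C_b_add[OF assms(1) C_b_scale[OF assms(2), of "-1"]] by simp

lemma sup_norm_scale:
  assumes "f \<in> C_b X"
  shows "sup_norm X (\<lambda>x. c * f x) = norm c * sup_norm X f"
proof (rule antisym)
  show "sup_norm X (\<lambda>x. c * f x) \<le> norm c * sup_norm X f"
    using norm_le_sup_norm[OF assms] sup_norm_nonneg[OF assms]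
    by (intro sup_norm_le) (auto simp: norm_mult intro!: mult_left_mono)
  show "norm c * sup_norm X f \<le> sup_norm X (\<lambda>x. c * f x)"
  proof (cases "c = 0")
    case True
    then show ?thesis using sup_norm_nonneg[OF C_b_zero] by simp
  next
    case False
    have "sup_norm X f \<le> sup_norm X (\<lambda>x. c * f x) / norm c"
      using norm_le_sup_norm[OF C_b_scale[OF assms, of c]] sup_norm_nonneg[OF C_b_scale[OF assms, of c]] False
      by (intro sup_norm_le) (auto simp: norm_mult field_simps)
    then show ?thesis using False by (simp add: field_simps)
  qed
qed

text \<open>The pointwise limit is attained uniformly, so it is bounded and continuous.\<close>

lemma sup_norm_Cauchy_limit:
  fixes s :: "nat \<Rightarrow> 'a \<Rightarrow> 'k::{real_normed_field,banach}"
  assumes s: "\<And>n. s n \<in> C_b X"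
    and Cau: "\<And>e. 0 < e \<Longrightarrow> \<exists>N. \<forall>m\<ge>N. \<forall>n\<ge>N. sup_norm X (\<lambda>x. s m x - s n x) < e"
  obtains f where "f \<in> C_b X" "(\<lambda>n. sup_norm X (\<lambda>x. s n x - f x)) \<longlonglongrightarrow> 0"
proof -
  have dif: "norm (s m x - s n x) \<le> sup_norm X (\<lambda>x. s m x - s n x)" for m n x
    using norm_le_sup_norm[OF C_b_diff[OF s s]] .
  define f where "f = (\<lambda>x. lim (\<lambda>n. s n x))"
  have lim: "(\<lambda>n. s n x) \<longlonglongrightarrow> f x" for x
  proof -
    have "Cauchy (\<lambda>n. s n x)"
      unfolding Cauchy_def dist_norm using Cau dif le_less_trans by meson
    then show ?thesis unfolding f_def by (simp add: Cauchy_convergent_iff convergent_LIMSEQ_iff)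
  qed
  have unif: "\<exists>N. \<forall>n\<ge>N. \<forall>x. norm (s n x - f x) \<le> e" if e: "e > 0" for e
  proof -
    obtain N where N: "\<And>m n. m \<ge> N \<Longrightarrow> n \<ge> N \<Longrightarrow> sup_norm X (\<lambda>x. s m x - s n x) < e"
      using Cau[OF e] by blast
    have "norm (s n x - f x) \<le> e" if "n \<ge> N" for n x
    proof (rule tendsto_upperbound)
      show "(\<lambda>m. norm (s n x - s m x)) \<longlonglongrightarrow> norm (s n x - f x)"
        by (intro tendsto_intros lim)
      show "\<forall>\<^sub>F m in sequentially. norm (s n x - s m x) \<le> e"
        using N[OF that] dif by (auto simp: eventually_sequentially intro!: exI[of _ N])
          (meson less_le_not_le order_trans)
    qed simp
    then show ?thesis by blast
  qed
  have f: "f \<in> C_b X"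
  proof -
    obtain N where N: "\<And>n x. n \<ge> N \<Longrightarrow> norm (s n x - f x) \<le> 1"
      using unif[of 1] by auto
    show ?thesis
    proof (rule C_b_I)
      show "norm (f x) \<le> sup_norm X (s N) + 1" for x
        using N[of N x] norm_le_sup_norm[OF s, of N x] norm_triangle_ineq2[of "f x" "s N x"]
        by (simp add: norm_minus_commute)
      show "f x = 0" if "x \<notin> topspace X" for x
        using LIMSEQ_unique[OF lim[of x]] C_b_outside[OF s that] by simp
      show "continuous_map X euclidean f"
        unfolding continuous_map_euclidean_iff_tendsto
      proof (intro ballI tendstoI)
        fix x and e :: real assume x: "x \<in> topspace X" and e: "0 < e"
        obtain n where n: "\<And>y. norm (s n y - f y) \<le> e/4"
          using unif[of "e/4"] e by auto
        have "(s n \<longlongrightarrow> s n x) (atin X x)"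
          using C_b_continuous[OF s] x unfolding continuous_map_euclidean_iff_tendsto by blast
        then have "\<forall>\<^sub>F y in atin X x. dist (s n y) (s n x) < e/4"
          using e tendstoD[of "s n" "s n x" "atin X x" "e/4"] by simp
        then show "\<forall>\<^sub>F y in atin X x. dist (f y) (f x) < e"
        proof (rule eventually_mono)
          fix y assume y: "dist (s n y) (s n x) < e/4"
          have "dist (f y) (f x) \<le> dist (f y) (s n y) + dist (s n y) (s n x) + dist (s n x) (f x)"
            using dist_triangle[of "f y" "f x" "s n y"] dist_triangle[of "s n y" "f x" "s n x"] by linarith
          also have "\<dots> \<le> e/4 + e/4 + e/4"
            using y n[of y] n[of x] by (simp add: dist_norm norm_minus_commute)
          also have "\<dots> < e" using e by simp
          finally show "dist (f y) (f x) < e" .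
        qed
      qed
    qed
  qed
  have "(\<lambda>n. sup_norm X (\<lambda>x. s n x - f x)) \<longlonglongrightarrow> 0"
  proof (rule LIMSEQ_I)
    fix e :: real assume "0 < e"
    then obtain N where N: "\<And>n x. n \<ge> N \<Longrightarrow> norm (s n x - f x) \<le> e/2"
      using unif[of "e/2"] by auto
    have "norm (sup_norm X (\<lambda>x. s n x - f x) - 0) < e" if "n \<ge> N" for n
    proof -
      have "sup_norm X (\<lambda>x. s n x - f x) \<le> e/2"
        using N[OF that] \<open>0 < e\<close> by (intro sup_norm_le) auto
      then show ?thesis using sup_norm_nonneg[OF C_b_diff[OF s f], of n] \<open>0 < e\<close> by simp
    qed
    then show "\<exists>N. \<forall>n\<ge>N. norm (sup_norm X (\<lambda>x. s n x - f x) - 0) < e" by blast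
  qed
  with f show thesis using that by blast
qed

text \<open>The algebraic laws and the norm inequalities hold pointwise, so a set of bounded continuous functions
is a Banach algebra as soon as it is closed under the operations and under uniform limits.\<close>

lemma banach_algebra_fun_alg:
  fixes F :: "('a \<Rightarrow> 'k::{real_normed_field,banach}) set"
  assumes sub: "F \<subseteq> C_b X" and zero: "(\<lambda>x. 0) \<in> F"
    and add: "\<And>f g. f \<in> F \<Longrightarrow> g \<in> F \<Longrightarrow> (\<lambda>x. f x + g x) \<in> F"
    and mult: "\<And>f g. f \<in> F \<Longrightarrow> g \<in> F \<Longrightarrow> (\<lambda>x. f x * g x) \<in> F"
    and scale: "\<And>c f. f \<in> F \<Longrightarrow> (\<lambda>x. c * f x) \<in> F"
    and limit: "\<And>s f. (\<And>n. s n \<in> F) \<Longrightarrow> f \<in> C_b X \<Longrightarrow>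
          (\<lambda>n. sup_norm X (\<lambda>x. s n x - f x)) \<longlonglongrightarrow> 0 \<Longrightarrow> f \<in> F"
  shows "banach_algebra (fun_alg X F)"
proof
  fix f g assume "f \<in> carr (fun_alg X F)" "g \<in> carr (fun_alg X F)"
  then have fg: "f \<in> C_b X" "g \<in> C_b X" using sub by (auto simp: fun_alg_def)
  have "sup_norm X (\<lambda>x. f x + g x) \<le> sup_norm X f + sup_norm X g"
  proof (rule sup_norm_le)
    show "norm (f x + g x) \<le> sup_norm X f + sup_norm X g" for x
      using fg[THEN norm_le_sup_norm, of x] norm_triangle_ineq[of "f x" "g x"] by linarith
  qed (use sup_norm_nonneg[OF fg(1)] sup_norm_nonneg[OF fg(2)] in simp)
  then show "nrm (fun_alg X F) (normed_alg.add (fun_alg X F) f g) \<le> nrm (fun_alg X F) f + nrm (fun_alg X F) g"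
    by (simp add: fun_alg_def)
  have "sup_norm X (\<lambda>x. f x * g x) \<le> sup_norm X f * sup_norm X g"
  proof (rule sup_norm_le)
    show "norm (f x * g x) \<le> sup_norm X f * sup_norm X g" for x
      unfolding norm_mult using fg[THEN norm_le_sup_norm, of x] sup_norm_nonneg[OF fg(1)]
      by (intro mult_mono) auto
  qed (use sup_norm_nonneg[OF fg(1)] sup_norm_nonneg[OF fg(2)] in simp)
  then show "nrm (fun_alg X F) (normed_alg.mult (fun_alg X F) f g) \<le> nrm (fun_alg X F) f * nrm (fun_alg X F) g"
    by (simp add: fun_alg_def)
next
  fix f and c :: 'k assume f: "f \<in> carr (fun_alg X F)"
  then have f': "f \<in> C_b X" using sub by (auto simp: fun_alg_def)
  show "0 \<le> nrm (fun_alg X F) f"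
    using sup_norm_nonneg[OF f'] by (simp add: fun_alg_def)
  show "nrm (fun_alg X F) (normed_alg.scale (fun_alg X F) c f) = norm c * nrm (fun_alg X F) f"
    using sup_norm_scale[OF f'] by (simp add: fun_alg_def)
  show "(nrm (fun_alg X F) f = 0) = (f = normed_alg.zero (fun_alg X F))"
  proof -
    have "f = (\<lambda>x. 0)" if "sup_norm X f = 0"
      using norm_le_sup_norm[OF f'] that by auto
    moreover have "sup_norm X (\<lambda>x. 0::'k) = 0"
      using sup_norm_scale[OF f', of 0] by simp
    ultimately show ?thesis by (auto simp: fun_alg_def)
  qed
  show "\<exists>y\<in>carr (fun_alg X F). normed_alg.add (fun_alg X F) f y = normed_alg.zero (fun_alg X F)"
    using scale[of f "-1"] f by (intro bexI[of _ "\<lambda>x. - 1 * f x"]) (auto simp: fun_alg_def)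
next
  fix s :: "nat \<Rightarrow> 'a \<Rightarrow> 'k"
  assume s: "\<And>n. s n \<in> carr (fun_alg X F)"
    and Cau: "\<And>e. 0 < e \<Longrightarrow>
      \<exists>N. \<forall>m\<ge>N. \<forall>n\<ge>N. nrm (fun_alg X F) (diff (fun_alg X F) (s m) (s n)) < e"
  have sF: "s n \<in> F" for n using s by (simp add: fun_alg_def)
  have sC: "s n \<in> C_b X" for n using sF sub by blast
  obtain f where f: "f \<in> C_b X" "(\<lambda>n. sup_norm X (\<lambda>x. s n x - f x)) \<longlonglongrightarrow> 0"
    by (rule sup_norm_Cauchy_limit[OF sC]) (use Cau in \<open>auto simp: fun_alg_def diff_def\<close>)
  then show "\<exists>l\<in>carr (fun_alg X F). (\<lambda>n. nrm (fun_alg X F) (diff (fun_alg X F) (s n) l)) \<longlonglongrightarrow> 0"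
    using limit[OF sF f] by (intro bexI[of _ f]) (auto simp: fun_alg_def diff_def)
qed (use zero add mult scale in \<open>auto simp: fun_alg_def algebra_simps\<close>)

text \<open>The support is the closure of the cozero set, and closures of separable sets are separable.\<close>

lemma C_s_iff:
  assumes "metrizable_space X"
  shows "f \<in> C_s X \<longleftrightarrow> f \<in> C_b X \<and> separable_in X (Coz X f)"
proof -
  have "Coz X f \<subseteq> supp X f"
    unfolding supp_def by (rule closure_of_subset) (auto simp: Coz_def)
  moreover have "supp X f \<subseteq> topspace X"
    unfolding supp_def by (rule closure_of_subset_topspace)
  ultimately show ?thesis
    unfolding C_s_def using separable_space_subtopology_iff[OF assms]
    by (auto simp: supp_def intro: separable_in_subset separable_in_closure)
qed

text \<open>Cozero sets of sums and products lie in the union of the two cozero sets, and that of a uniform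
limit lies in the countable union of the cozero sets of the sequence.\<close>

lemma banach_algebra_C_s:
  assumes "metrizable_space X"
  shows "banach_algebra (fun_alg X (C_s X :: ('a \<Rightarrow> 'k::{real_normed_field,banach}) set))"
proof (rule banach_algebra_fun_alg)
  note iff = C_s_iff[OF assms]
  show "C_s X \<subseteq> C_b X" unfolding C_s_def by auto
  show "(\<lambda>x. 0) \<in> C_s X"
    unfolding iff by (auto simp: C_b_zero Coz_def separable_in_def intro!: exI[of _ "{}"])
  fix f g :: "'a \<Rightarrow> 'k" and c assume f: "f \<in> C_s X"
  show "(\<lambda>x. c * f x) \<in> C_s X"
    using f unfolding iff by (auto simp: Coz_def intro: C_b_scale separable_in_subset)
  assume g: "g \<in> C_s X"
  show "(\<lambda>x. f x * g x) \<in> C_s X"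
    using f g unfolding iff by (auto simp: Coz_def intro: C_b_mult separable_in_subset)
  have "separable_in X (Coz X f \<union> Coz X g)"
    using f g unfolding iff by (auto intro: separable_in_Un)
  then have "separable_in X (Coz X (\<lambda>x. f x + g x))"
    by (rule separable_in_subset) (auto simp: Coz_def)
  then show "(\<lambda>x. f x + g x) \<in> C_s X"
    using f g C_b_add unfolding iff by auto
next
  note iff = C_s_iff[OF assms]
  fix s and f :: "'a \<Rightarrow> 'k"
  assume s: "\<And>n. s n \<in> C_s X" and f: "f \<in> C_b X"
    and lim: "(\<lambda>n. sup_norm X (\<lambda>x. s n x - f x)) \<longlonglongrightarrow> 0"
  have sC: "s n \<in> C_b X" for n using s unfolding iff by auto
  have "Coz X f \<subseteq> (\<Union>n. Coz X (s n))"
  proof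
    fix x assume x: "x \<in> Coz X f"
    then have "norm (f x) > 0" unfolding Coz_def by simp
    then obtain n where n: "norm (sup_norm X (\<lambda>x. s n x - f x)) < norm (f x)"
      using LIMSEQ_D[OF lim, of "norm (f x)"] by auto
    have "norm (s n x - f x) < norm (f x)"
      using n norm_le_sup_norm[OF C_b_diff[OF sC f], of n x] by simp
    then have "s n x \<noteq> 0" by auto
    then show "x \<in> (\<Union>n. Coz X (s n))" using x unfolding Coz_def by auto
  qed
  moreover have "separable_in X (\<Union>n. Coz X (s n))"
    by (rule separable_in_countable_UN) (use s iff in auto)
  ultimately show "f \<in> C_s X"
    unfolding iff using f separable_in_subset by blast
qed

section \<open>Functions vanishing at infinity\<close>

lemma C_0_subset_C_b: "f \<in> C_0 Y \<Longrightarrow> f \<in> C_b Y"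
  unfolding C_0_def by simp

lemma closedin_norm_ge:
  assumes "continuous_map Y euclidean f"
  shows "closedin Y {y \<in> topspace Y. \<epsilon> \<le> norm (f y)}"
proof -
  have "continuous_map Y euclidean (\<lambda>y. norm (f y))"
    using assms unfolding continuous_map_euclidean_iff_tendsto by (auto intro: tendsto_norm)
  then have "closedin Y {y \<in> topspace Y. norm (f y) \<in> {\<epsilon>..}}"
    by (rule closedin_continuous_map_preimage) simp
  then show ?thesis by simp
qed

lemma openin_norm_gt:
  assumes "continuous_map Y euclidean f"
  shows "openin Y {y \<in> topspace Y. \<epsilon> < norm (f y)}"
proof -
  have "continuous_map Y euclidean (\<lambda>y. norm (f y))"
    using assms unfolding continuous_map_euclidean_iff_tendsto by (auto intro: tendsto_norm)
  then have "openin Y {y \<in> topspace Y. norm (f y) \<in> {\<epsilon><..}}"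
    by (rule openin_continuous_map_preimage) simp
  then show ?thesis by simp
qed

text \<open>The level sets of \<open>h\<close> are closed subsets of level sets of \<open>f\<close>.\<close>

lemma C_0_dominated:
  assumes f: "f \<in> C_0 Y" and h: "h \<in> C_b Y" and le: "\<And>y. norm (h y) \<le> c * norm (f y)"
  shows "h \<in> C_0 Y"
  unfolding C_0_def
proof (intro CollectI conjI h allI impI)
  fix \<epsilon> :: real assume "\<epsilon> > 0"
  define d where "d = \<epsilon> / (\<bar>c\<bar> + 1)"
  have "d > 0" unfolding d_def using \<open>\<epsilon> > 0\<close> by simp
  have "compactin Y {y \<in> topspace Y. d \<le> norm (f y)}"
    using f \<open>d > 0\<close> unfolding C_0_def by auto
  moreover have "{y \<in> topspace Y. \<epsilon> \<le> norm (h y)} \<subseteq> {y \<in> topspace Y. d \<le> norm (f y)}"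
  proof clarify
    fix y assume "\<epsilon> \<le> norm (h y)"
    also have "norm (h y) \<le> c * norm (f y)" by (rule le)
    also have "\<dots> \<le> (\<bar>c\<bar> + 1) * norm (f y)" by (intro mult_right_mono) auto
    finally show "d \<le> norm (f y)" unfolding d_def by (simp add: field_simps)
  qed
  moreover have "closedin Y {y \<in> topspace Y. \<epsilon> \<le> norm (h y)}"
    by (rule closedin_norm_ge[OF C_b_continuous[OF h]])
  ultimately show "compactin Y {y \<in> topspace Y. \<epsilon> \<le> norm (h y)}"
    by (rule closed_compactin)
qed

lemma C_0_mult: 
  assumes "f \<in> C_0 Y" "g \<in> C_b Y" shows "(\<lambda>y. f y * g y) \<in> C_0 Y"
proof (rule C_0_dominated[OF assms(1) C_b_mult[OF C_0_subset_C_b[OF assms(1)] assms(2)]])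
  show "norm (f y * g y) \<le> sup_norm Y g * norm (f y)" for y
    using mult_right_mono[OF norm_le_sup_norm[OF assms(2), of y] norm_ge_zero[of "f y"]]
    by (simp add: norm_mult mult.commute)
qed

lemma C_0_scale:
  assumes "f \<in> C_0 Y" shows "(\<lambda>y. c * f y) \<in> C_0 Y"
  by (rule C_0_dominated[OF assms C_b_scale[OF C_0_subset_C_b[OF assms]], where c = "norm c"])
    (simp add: norm_mult)

lemma C_0_zero: "(\<lambda>y. 0) \<in> C_0 Y"
  unfolding C_0_def by (auto simp: C_b_zero)

lemma C_0_add:
  assumes f: "f \<in> C_0 Y" and g: "g \<in> C_0 Y"
  shows "(\<lambda>y. f y + g y) \<in> C_0 Y"
  unfolding C_0_def
proof (intro CollectI conjI allI impI)
  show h: "(\<lambda>y. f y + g y) \<in> C_b Y" using f g by (intro C_b_add C_0_subset_C_b)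
  fix \<epsilon> :: real assume "\<epsilon> > 0"
  have "compactin Y ({y \<in> topspace Y. \<epsilon>/2 \<le> norm (f y)} \<union> {y \<in> topspace Y. \<epsilon>/2 \<le> norm (g y)})"
    using f g half_gt_zero[OF \<open>\<epsilon> > 0\<close>] unfolding C_0_def by (intro compactin_Un) blast+
  moreover have "{y \<in> topspace Y. \<epsilon> \<le> norm (f y + g y)}
      \<subseteq> {y \<in> topspace Y. \<epsilon>/2 \<le> norm (f y)} \<union> {y \<in> topspace Y. \<epsilon>/2 \<le> norm (g y)}"
  proof
    fix y assume "y \<in> {y \<in> topspace Y. \<epsilon> \<le> norm (f y + g y)}"
    then show "y \<in> {y \<in> topspace Y. \<epsilon>/2 \<le> norm (f y)} \<union> {y \<in> topspace Y. \<epsilon>/2 \<le> norm (g y)}"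
      using norm_triangle_ineq[of "f y" "g y"] by auto
  qed
  moreover have "closedin Y {y \<in> topspace Y. \<epsilon> \<le> norm (f y + g y)}"
    by (rule closedin_norm_ge[OF C_b_continuous[OF h]])
  ultimately show "compactin Y {y \<in> topspace Y. \<epsilon> \<le> norm (f y + g y)}"
    by (rule closed_compactin)
qed

lemma C_0_sum:
  "finite T \<Longrightarrow> (\<And>t. t \<in> T \<Longrightarrow> f t \<in> C_0 Y) \<Longrightarrow> (\<lambda>y. \<Sum>t\<in>T. f t y) \<in> C_0 Y"
  by (induction T rule: finite_induct) (auto simp: C_0_zero C_0_add)

text \<open>The point has an open neighbourhood inside a compact set \<open>K\<close>, and complete regularity gives a function
that is \<open>1\<close> at the point and vanishes off the part of \<open>U\<close> lying in that neighbourhood.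
Its level sets are then closed subsets of \<open>K\<close>.\<close>

lemma C_0_separates:
  assumes lc: "locally_compact_space Y" and H: "Hausdorff_space Y" and U: "openin Y U" and y: "y \<in> U"
  shows "\<exists>f :: 'y \<Rightarrow> 'k::real_normed_field. f \<in> C_0 Y \<and> f y = 1 \<and> (\<forall>x. x \<notin> U \<longrightarrow> f x = 0)"
proof -
  have yY: "y \<in> topspace Y" using openin_subset[OF U] y by blast
  then obtain W K where W: "openin Y W" "compactin Y K" "y \<in> W" "W \<subseteq> K"
    using lc unfolding locally_compact_space_def by blast
  have "completely_regular_space Y"
    using lc H locally_compact_Hausdorff_imp_regular_space locally_compact_regular_imp_completely_regular_space
    by blast
  moreover have "closedin Y (topspace Y - U \<inter> W)" using U W by blast
  moreover have "y \<in> topspace Y - (topspace Y - U \<inter> W)" using y yY W by blast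
  ultimately obtain g :: "'y \<Rightarrow> real" where g: "continuous_map Y (top_of_set {0..1}) g" "g y = 0"
      "g ` (topspace Y - U \<inter> W) \<subseteq> {1}"
    unfolding completely_regular_space_def by metis
  have gE: "continuous_map Y euclidean g" and g01: "\<And>x. x \<in> topspace Y \<Longrightarrow> g x \<in> {0..1}"
    using g(1) by (auto simp: continuous_map_in_subtopology)
  define f where "f = (\<lambda>x. if x \<in> topspace Y then of_real (1 - g x) else (0::'k))"
  have off: "f x = 0" if "x \<notin> U \<inter> W" for x
    using g(3) that unfolding f_def by auto
  have "continuous_map Y euclidean f"
  proof (rule continuous_map_eq[where f = "\<lambda>x. of_real (1 - g x)"])
    show "continuous_map Y euclidean (\<lambda>x. of_real (1 - g x) :: 'k)"
      using gE unfolding continuous_map_euclidean_iff_tendsto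
      by (auto intro!: tendsto_of_real tendsto_diff)
  qed (simp add: f_def)
  then have f: "f \<in> C_b Y"
  proof (rule C_b_I[where c=1])
    fix x assume "x \<in> topspace Y"
    have "norm (of_real (1 - g x) :: 'k) = \<bar>1 - g x\<bar>" by (rule norm_of_real)
    then show "norm (f x) \<le> 1" using g01[OF \<open>x \<in> topspace Y\<close>] \<open>x \<in> topspace Y\<close> by (simp add: f_def)
  qed (simp add: f_def)
  have "f \<in> C_0 Y"
    unfolding C_0_def
  proof (intro CollectI conjI f allI impI)
    fix \<epsilon> :: real assume "\<epsilon> > 0"
    then have "{y \<in> topspace Y. \<epsilon> \<le> norm (f y)} \<subseteq> K"
      using off W by fastforce
    then show "compactin Y {y \<in> topspace Y. \<epsilon> \<le> norm (f y)}"
      using closed_compactin[OF W(2) _ closedin_norm_ge[OF C_b_continuous[OF f]]] by blast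
  qed
  moreover have "f y = 1" unfolding f_def using yY g(2) by simp
  ultimately show ?thesis using off by blast
qed

text \<open>Over the reals and over the complex numbers this is conjugation. It is continuous, and its product with
\<open>z\<close> is \<open>\<bar>z\<bar>\<^sup>2\<close>, in every normed field.\<close>

definition conj_like :: "'k::real_normed_field \<Rightarrow> 'k" where
  "conj_like z = inverse z * of_real ((norm z)\<^sup>2)"

lemma conj_like_mult_self: "conj_like z * z = of_real ((norm z)\<^sup>2)"
  unfolding conj_like_def by (cases "z = 0") auto

lemma norm_conj_like [simp]: "norm (conj_like z) = norm z"
  unfolding conj_like_def by (cases "z = 0") (auto simp: norm_mult norm_inverse power2_eq_square)

lemma tendsto_conj_like:
  assumes "(f \<longlongrightarrow> l) F"
  shows "((\<lambda>x. conj_like (f x)) \<longlongrightarrow> conj_like l) F"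
proof (cases "l = 0")
  case True
  have "((\<lambda>x. norm (f x)) \<longlongrightarrow> 0) F" using assms True tendsto_norm_zero by blast
  then have "((\<lambda>x. norm (conj_like (f x))) \<longlongrightarrow> 0) F" by simp
  then have "((\<lambda>x. conj_like (f x)) \<longlongrightarrow> 0) F" by (rule tendsto_norm_zero_cancel)
  then show ?thesis using True by (simp add: conj_like_def)
next
  case False
  then show ?thesis unfolding conj_like_def by (intro tendsto_intros assms)
qed

lemma C_0_conj_like:
  assumes f: "f \<in> C_0 Y"
  shows "(\<lambda>y. conj_like (f y)) \<in> C_0 Y"
proof (rule C_0_dominated[OF f, where c=1])
  show "(\<lambda>y. conj_like (f y)) \<in> C_b Y"
  proof (rule C_b_I)
    show "continuous_map Y euclidean (\<lambda>y. conj_like (f y))"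
      using C_b_continuous[OF C_0_subset_C_b[OF f]] unfolding continuous_map_euclidean_iff_tendsto
      by (auto intro: tendsto_conj_like)
    show "norm (conj_like (f y)) \<le> sup_norm Y f" for y
      using norm_le_sup_norm[OF C_0_subset_C_b[OF f]] by simp
    show "conj_like (f y) = 0" if "y \<notin> topspace Y" for y
      using C_b_outside[OF C_0_subset_C_b[OF f] that] by (simp add: conj_like_def)
  qed
qed simp

text \<open>Suppose the kernel has no common zero. Then finitely many of its elements have no common zero on the
compact set \<open>K\<close> where \<open>\<bar>e\<bar> \<ge> \<bar>\<omega> e\<bar> / 2\<close>, and the sum \<open>f\<close> of their squared absolute values lies in the
kernel and can be taken to be at least \<open>1\<close> on \<open>K\<close>. The kernel then contains \<open>m = e f / max f 1\<close>, which
equals \<open>e\<close> on \<open>K\<close> and is no further than \<open>\<bar>e\<bar>\<close> from \<open>e\<close> elsewhere. So \<open>\<bar>\<omega> e\<bar> = \<bar>\<omega> (e - m)\<bar>\<close> is at most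
\<open>\<bar>\<omega> e\<bar> / 2\<close>, which is absurd.\<close>

lemma C_0_character_kernel_common_zero:
  fixes \<omega> :: "('y \<Rightarrow> 'k::real_normed_field) \<Rightarrow> 'k"
  assumes add: "\<And>f g. f \<in> C_0 Y \<Longrightarrow> g \<in> C_0 Y \<Longrightarrow> \<omega> (\<lambda>y. f y + g y) = \<omega> f + \<omega> g"
    and mult: "\<And>f g. f \<in> C_0 Y \<Longrightarrow> g \<in> C_0 Y \<Longrightarrow> \<omega> (\<lambda>y. f y * g y) = \<omega> f * \<omega> g"
    and scale: "\<And>c f. f \<in> C_0 Y \<Longrightarrow> \<omega> (\<lambda>y. c * f y) = c * \<omega> f"
    and bound: "\<And>f. f \<in> C_0 Y \<Longrightarrow> norm (\<omega> f) \<le> sup_norm Y f"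
    and e: "e \<in> C_0 Y" "\<omega> e \<noteq> 0"
  shows "\<exists>y\<in>topspace Y. \<forall>f\<in>C_0 Y. \<omega> f = 0 \<longrightarrow> f y = 0"
proof (rule ccontr)
  assume contra: "\<not> ?thesis"
  have "\<exists>p\<in>C_0 Y. \<omega> p = 0 \<and> 1 < norm (p y)" if y: "y \<in> topspace Y" for y
  proof -
    obtain f where f: "f \<in> C_0 Y" "\<omega> f = 0" "f y \<noteq> 0" using contra y by blast
    \<comment> \<open>The scaling makes the neighbourhoods below carry the bound \<open>1\<close>, so that no minimum of \<open>F\<close> over \<open>K\<close>
      has to be taken.\<close>
    have "norm (2 / f y * f y) = 2" using f(3) by simp
    then show ?thesis
      using f C_0_scale[OF f(1), of "2 / f y"] scale[OF f(1), of "2 / f y"]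
      by (intro bexI[of _ "\<lambda>x. 2 / f y * f x"]) auto
  qed
  then obtain p where p: "\<And>y. y \<in> topspace Y \<Longrightarrow> p y \<in> C_0 Y"
      "\<And>y. y \<in> topspace Y \<Longrightarrow> \<omega> (p y) = 0" "\<And>y. y \<in> topspace Y \<Longrightarrow> 1 < norm (p y y)"
    by metis
  define \<epsilon> where "\<epsilon> = norm (\<omega> e) / 2"
  have "\<epsilon> > 0" unfolding \<epsilon>_def using e by simp
  define K where "K = {y \<in> topspace Y. \<epsilon> \<le> norm (e y)}"
  have K: "compactin Y K" "K \<subseteq> topspace Y"
    using e(1) \<open>\<epsilon> > 0\<close> unfolding C_0_def K_def by auto
  define V where "V = (\<lambda>y. {x \<in> topspace Y. 1 < norm (p y x)})"
  have "openin Y (V y)" if "y \<in> topspace Y" for y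
    unfolding V_def by (rule openin_norm_gt[OF C_b_continuous[OF C_0_subset_C_b[OF p(1)[OF that]]]])
  then have "openin Y U" if "U \<in> V ` K" for U using that K(2) by blast
  moreover have "K \<subseteq> \<Union> (V ` K)" using p(3) K unfolding V_def by blast
  ultimately obtain \<F> where "finite \<F>" "\<F> \<subseteq> V ` K" "K \<subseteq> \<Union>\<F>"
    using compactinD[OF K(1), of "V ` K"] by blast
  then obtain T where T: "finite T" "T \<subseteq> K" "K \<subseteq> \<Union> (V ` T)"
    by (metis finite_subset_image)
  define q where "q = (\<lambda>y x. conj_like (p y x) * p y x)"
  have q: "q y \<in> C_0 Y" "\<omega> (q y) = 0" if "y \<in> T" for y
    using that T K p C_0_mult[OF C_0_conj_like C_0_subset_C_b, of "p y" Y "p y"]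
      mult[OF C_0_conj_like, of "p y" "p y"] unfolding q_def by auto
  define F where "F = (\<lambda>x. \<Sum>y\<in>T. (norm (p y x))\<^sup>2)"
  define f where "f = (\<lambda>x. \<Sum>y\<in>T. q y x)"
  have f: "f \<in> C_0 Y" unfolding f_def using T q by (intro C_0_sum) auto
  have "\<omega> (\<lambda>x. \<Sum>y\<in>S. q y x) = 0" if "finite S" "S \<subseteq> T" for S
    using that
  proof (induction S rule: finite_induct)
    case empty
    show ?case using scale[OF C_0_zero, of 0] by simp
  next
    case (insert s S)
    then have "\<omega> (\<lambda>x. q s x + (\<Sum>y\<in>S. q y x)) = \<omega> (q s) + \<omega> (\<lambda>x. \<Sum>y\<in>S. q y x)"
      using q C_0_sum[of S q Y] by (intro add) auto
    then show ?case using insert q by simp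
  qed
  then have \<omega>f: "\<omega> f = 0" unfolding f_def using T by blast
  have fF: "f x = of_real (F x)" for x
    unfolding f_def F_def q_def conj_like_mult_self by simp
  have F0: "0 \<le> F x" for x unfolding F_def by (intro sum_nonneg) auto
  have F1: "1 \<le> F x" if x: "x \<in> K" for x
  proof -
    obtain y where y: "y \<in> T" "1 < norm (p y x)" using T x unfolding V_def by blast
    have "1 \<le> (norm (p y x))\<^sup>2" using y(2) one_le_power[of "norm (p y x)" 2] by simp
    also have "\<dots> \<le> F x" unfolding F_def using y T by (intro member_le_sum) auto
    finally show ?thesis .
  qed
  have Fcont: "(F \<longlongrightarrow> F x) (atin Y x)" if "x \<in> topspace Y" for x
    unfolding F_def
  proof (intro tendsto_sum tendsto_power tendsto_norm)
    fix y assume "y \<in> T"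
    then have "p y \<in> C_b Y" using T K p C_0_subset_C_b by blast
    then show "(p y \<longlongrightarrow> p y x) (atin Y x)"
      using C_b_continuous that unfolding continuous_map_euclidean_iff_tendsto by blast
  qed
  \<comment> \<open>The kernel element \<open>m = f h\<close> agrees with \<open>e\<close> on \<open>K\<close>, where \<open>F \<ge> 1\<close>.\<close>
  define h where "h = (\<lambda>x. of_real (inverse (max (F x) 1)) * e x)"
  have nh: "norm (h x) \<le> 1 * norm (e x)" for x
  proof -
    have "norm (of_real (inverse (max (F x) 1)) :: 'k) = \<bar>inverse (max (F x) 1)\<bar>"
      by (rule norm_of_real)
    also have "\<dots> \<le> 1" by (simp add: inverse_eq_divide)
    finally show ?thesis unfolding h_def norm_mult by (intro mult_right_mono) auto
  qed
  have h: "h \<in> C_0 Y"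
  proof (rule C_0_dominated[OF e(1) _ nh])
    show "h \<in> C_b Y"
    proof (rule C_b_I)
      show "continuous_map Y euclidean h"
        unfolding continuous_map_euclidean_iff_tendsto
      proof
        fix x assume x: "x \<in> topspace Y"
        have "(e \<longlongrightarrow> e x) (atin Y x)"
          using C_b_continuous[OF C_0_subset_C_b[OF e(1)]] x
          unfolding continuous_map_euclidean_iff_tendsto by blast
        moreover have "max (F x) 1 \<noteq> 0" using F0 by (simp add: max_def)
        ultimately show "(h \<longlongrightarrow> h x) (atin Y x)"
          unfolding h_def using Fcont[OF x]
          by (intro tendsto_mult tendsto_of_real tendsto_inverse tendsto_max tendsto_const)
      qed
      show "norm (h x) \<le> sup_norm Y e" for x
        using nh[of x] norm_le_sup_norm[OF C_0_subset_C_b[OF e(1)], of x] by simp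
    qed (use C_b_outside[OF C_0_subset_C_b[OF e(1)]] in \<open>auto simp: h_def\<close>)
  qed
  define m where "m = (\<lambda>x. f x * h x)"
  have m: "m \<in> C_0 Y" "\<omega> m = 0"
    using C_0_mult[OF f C_0_subset_C_b[OF h]] mult[OF f h] \<omega>f unfolding m_def by auto
  define r where "r = (\<lambda>x. e x + (-1) * m x)"
  have r: "r \<in> C_0 Y" "\<omega> r = \<omega> e"
    using C_0_add[OF e(1) C_0_scale[OF m(1), of "-1"]] add[OF e(1) C_0_scale[OF m(1), of "-1"]]
      scale[OF m(1), of "-1"] m(2) unfolding r_def by auto
  have "sup_norm Y r \<le> \<epsilon>"
  proof (rule sup_norm_le)
    fix x assume x: "x \<in> topspace Y"
    have rx: "r x = of_real (1 - F x / max (F x) 1) * e x"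
      unfolding r_def m_def h_def fF by (simp add: field_simps)
    show "norm (r x) \<le> \<epsilon>"
    proof (cases "x \<in> K")
      case True
      then have "max (F x) 1 = F x" "F x \<noteq> 0" using F1[OF True] by auto
      then show ?thesis using rx \<open>\<epsilon> > 0\<close> by simp
    next
      case False
      have "0 \<le> F x / max (F x) 1" "F x / max (F x) 1 \<le> 1"
        using F0[of x] by (auto simp: divide_le_eq_1 less_max_iff_disj)
      then have "\<bar>1 - F x / max (F x) 1\<bar> \<le> 1" by simp
      then have "norm (r x) \<le> 1 * norm (e x)"
        unfolding rx norm_mult norm_of_real by (intro mult_right_mono) auto
      then show ?thesis using False x unfolding K_def by simp
    qed
  qed (use \<open>\<epsilon> > 0\<close> in simp)
  then have "norm (\<omega> e) \<le> \<epsilon>" using bound[OF r(1)] r(2) by simp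
  then show False using e(2) unfolding \<epsilon>_def by simp
qed

section \<open>The space is determined by the algebra of functions vanishing at infinity\<close>

text \<open>The kernel vanishes at some point \<open>y\<close>, so evaluation at \<open>y\<close> is a multiple of the character;
multiplicativity forces the factor to be \<open>1\<close>.\<close>

lemma C_0_character_is_evaluation:
  fixes \<omega> :: "('y \<Rightarrow> 'k::real_normed_field) \<Rightarrow> 'k"
  assumes lc: "locally_compact_space Y" and H: "Hausdorff_space Y"
    and add: "\<And>f g. f \<in> C_0 Y \<Longrightarrow> g \<in> C_0 Y \<Longrightarrow> \<omega> (\<lambda>y. f y + g y) = \<omega> f + \<omega> g"
    and mult: "\<And>f g. f \<in> C_0 Y \<Longrightarrow> g \<in> C_0 Y \<Longrightarrow> \<omega> (\<lambda>y. f y * g y) = \<omega> f * \<omega> g"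
    and scale: "\<And>c f. f \<in> C_0 Y \<Longrightarrow> \<omega> (\<lambda>y. c * f y) = c * \<omega> f"
    and bound: "\<And>f. f \<in> C_0 Y \<Longrightarrow> norm (\<omega> f) \<le> sup_norm Y f"
    and e: "e \<in> C_0 Y" "\<omega> e \<noteq> 0"
  shows "\<exists>y\<in>topspace Y. \<forall>f\<in>C_0 Y. \<omega> f = f y"
proof -
  have "\<exists>y\<in>topspace Y. \<forall>f\<in>C_0 Y. \<omega> f = 0 \<longrightarrow> f y = 0"
    by (rule C_0_character_kernel_common_zero[where Y = Y and \<omega> = \<omega> and e = e])
      (assumption | rule add mult scale bound e)+
  then obtain y where y: "y \<in> topspace Y" and zero: "\<And>f. f \<in> C_0 Y \<Longrightarrow> \<omega> f = 0 \<Longrightarrow> f y = 0"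
    by blast
  have proport: "f y = \<omega> f / \<omega> e * e y" if f: "f \<in> C_0 Y" for f
  proof -
    let ?g = "\<lambda>x. f x + (- \<omega> f / \<omega> e) * e x"
    have "?g \<in> C_0 Y" using f e by (intro C_0_add C_0_scale)
    moreover have "\<omega> ?g = 0"
      using add[OF f C_0_scale[OF e(1), of "- \<omega> f / \<omega> e"]] scale[OF e(1), of "- \<omega> f / \<omega> e"] e(2) by simp
    ultimately have "?g y = 0" by (rule zero)
    then show ?thesis by simp
  qed
  obtain u :: "'y \<Rightarrow> 'k" where "u \<in> C_0 Y" "u y = 1"
    using C_0_separates[OF lc H openin_topspace y] by blast
  then have ey: "e y \<noteq> 0" using proport by fastforce
  have "e y * e y = \<omega> e * e y"
    using proport[OF C_0_mult[OF e(1) C_0_subset_C_b[OF e(1)]]] mult[OF e(1) e(1)] e(2) by simp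
  then have "e y = \<omega> e" using ey by simp
  then show ?thesis using proport y e(2) by auto
qed

text \<open>Evaluation at \<open>z\<close> is a character of \<open>C_0 Z\<close>; transported through \<open>A\<close> it becomes a character of \<open>C_0 Y\<close>,
which is evaluation at some \<open>y\<close>.\<close>

lemma isometric_copies_share_characters:
  fixes A :: "('k::real_normed_field, 'v) normed_alg" and Y :: "'y topology" and Z :: "'z topology"
  assumes A: "banach_algebra A"
    and lcY: "locally_compact_space Y" and HY: "Hausdorff_space Y"
    and lcZ: "locally_compact_space Z" and HZ: "Hausdorff_space Z"
    and \<phi>: "bij_betw \<phi> (carr A) (C_0 Y)"
      "\<And>a b. a \<in> carr A \<Longrightarrow> b \<in> carr A \<Longrightarrow> \<phi> (add A a b) = (\<lambda>y. \<phi> a y + \<phi> b y)"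
      "\<And>a b. a \<in> carr A \<Longrightarrow> b \<in> carr A \<Longrightarrow> \<phi> (mult A a b) = (\<lambda>y. \<phi> a y * \<phi> b y)"
      "\<And>c a. a \<in> carr A \<Longrightarrow> \<phi> (scale A c a) = (\<lambda>y. c * \<phi> a y)"
      "\<And>a. a \<in> carr A \<Longrightarrow> sup_norm Y (\<phi> a) = nrm A a"
    and \<psi>: "bij_betw \<psi> (carr A) (C_0 Z)"
      "\<And>a b. a \<in> carr A \<Longrightarrow> b \<in> carr A \<Longrightarrow> \<psi> (add A a b) = (\<lambda>y. \<psi> a y + \<psi> b y)"
      "\<And>a b. a \<in> carr A \<Longrightarrow> b \<in> carr A \<Longrightarrow> \<psi> (mult A a b) = (\<lambda>y. \<psi> a y * \<psi> b y)"
      "\<And>c a. a \<in> carr A \<Longrightarrow> \<psi> (scale A c a) = (\<lambda>y. c * \<psi> a y)"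
      "\<And>a. a \<in> carr A \<Longrightarrow> sup_norm Z (\<psi> a) = nrm A a"
    and z: "z \<in> topspace Z"
  shows "\<exists>y\<in>topspace Y. \<forall>a\<in>carr A. \<psi> a z = \<phi> a y"
proof -
  interpret banach_algebra A by (rule A)
  define i where "i = inv_into (carr A) \<phi>"
  have inj: "inj_on \<phi> (carr A)" and im: "\<phi> ` carr A = C_0 Y"
    using \<phi>(1) unfolding bij_betw_def by blast+
  have i: "i f \<in> carr A" "\<phi> (i f) = f" if "f \<in> C_0 Y" for f
    using that im inv_into_into[of f \<phi> "carr A"] f_inv_into_f[of f \<phi> "carr A"] unfolding i_def
    by simp_all
  have i\<phi>: "i (\<phi> a) = a" if "a \<in> carr A" for a
    unfolding i_def using inj that by (rule inv_into_f_f)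
  obtain u :: "'z \<Rightarrow> 'k" where u: "u \<in> C_0 Z" "u z = 1"
    using C_0_separates[OF lcZ HZ openin_topspace z] by blast
  have "u \<in> \<psi> ` carr A" unfolding bij_betw_imp_surj_on[OF \<psi>(1)] by (rule u(1))
  then obtain a where a: "a \<in> carr A" "\<psi> a = u" by (elim imageE) simp
  have "\<exists>y\<in>topspace Y. \<forall>f\<in>C_0 Y. \<psi> (i f) z = f y"
  proof (rule C_0_character_is_evaluation[OF lcY HY, where \<omega> = "\<lambda>f. \<psi> (i f) z"])
    fix f g :: "'y \<Rightarrow> 'k" assume f: "f \<in> C_0 Y" and g: "g \<in> C_0 Y"
    have "i (\<lambda>y. f y + g y) = add A (i f) (i g)"
      using i\<phi>[OF add_closed[OF i(1)[OF f] i(1)[OF g]]] \<phi>(2)[OF i(1)[OF f] i(1)[OF g]] i(2) f g by simp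
    then show "\<psi> (i (\<lambda>y. f y + g y)) z = \<psi> (i f) z + \<psi> (i g) z"
      using \<psi>(2) i(1) f g by simp
    have "i (\<lambda>y. f y * g y) = mult A (i f) (i g)"
      using i\<phi>[OF mult_closed[OF i(1)[OF f] i(1)[OF g]]] \<phi>(3)[OF i(1)[OF f] i(1)[OF g]] i(2) f g by simp
    then show "\<psi> (i (\<lambda>y. f y * g y)) z = \<psi> (i f) z * \<psi> (i g) z"
      using \<psi>(3) i(1) f g by simp
  next
    fix c and f :: "'y \<Rightarrow> 'k" assume f: "f \<in> C_0 Y"
    have "i (\<lambda>y. c * f y) = scale A c (i f)"
      using i\<phi>[OF scale_closed[OF i(1)[OF f]], of c] \<phi>(4)[OF i(1)[OF f]] i(2) f by simp
    then show "\<psi> (i (\<lambda>y. c * f y)) z = c * \<psi> (i f) z"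
      using \<psi>(4) i(1) f by simp
  next
    fix f :: "'y \<Rightarrow> 'k" assume f: "f \<in> C_0 Y"
    have "\<psi> (i f) \<in> C_b Z"
      using bij_betwE[OF \<psi>(1)] i(1)[OF f] C_0_subset_C_b by blast
    then have "norm (\<psi> (i f) z) \<le> sup_norm Z (\<psi> (i f))" by (rule norm_le_sup_norm)
    also have "\<dots> = sup_norm Y f" using \<psi>(5) \<phi>(5) i f by metis
    finally show "norm (\<psi> (i f) z) \<le> sup_norm Y f" .
  next
    show "\<phi> a \<in> C_0 Y" using a im by blast
    show "\<psi> (i (\<phi> a)) z \<noteq> 0" using i\<phi> a u by simp
  qed
  then obtain y where "y \<in> topspace Y" "\<And>f. f \<in> C_0 Y \<Longrightarrow> \<psi> (i f) z = f y" by blast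
  then show ?thesis using im i\<phi> by (metis imageI)
qed

text \<open>The cozero sets of functions in \<open>C_0 Y\<close> form a base of the topology of \<open>Y\<close>.\<close>

lemma continuous_map_if_C_0_pullback:
  fixes Y :: "'y topology" and Z :: "'z topology"
  assumes "locally_compact_space Y" "Hausdorff_space Y"
    and \<tau>: "\<And>z. z \<in> topspace Z \<Longrightarrow> \<tau> z \<in> topspace Y"
    and pull: "\<And>f :: 'y \<Rightarrow> 'k::real_normed_field. f \<in> C_0 Y \<Longrightarrow>
      \<exists>g. continuous_map Z euclidean g \<and> (\<forall>z\<in>topspace Z. (g z :: 'k) = f (\<tau> z))"
  shows "continuous_map Z Y \<tau>"
  unfolding continuous_map_def
proof (intro conjI allI impI)
  show "\<tau> \<in> topspace Z \<rightarrow> topspace Y" by (rule Pi_I) (rule \<tau>)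
  fix U assume U: "openin Y U"
  show "openin Z {z \<in> topspace Z. \<tau> z \<in> U}"
  proof (subst openin_subopen, intro ballI)
    fix z assume z: "z \<in> {z \<in> topspace Z. \<tau> z \<in> U}"
    then have "\<tau> z \<in> U" by blast
    obtain f :: "'y \<Rightarrow> 'k" where f: "f \<in> C_0 Y" "f (\<tau> z) = 1" "\<And>x. x \<notin> U \<Longrightarrow> f x = 0"
      using C_0_separates[OF assms(1,2) U \<open>\<tau> z \<in> U\<close>] by blast
    then obtain g where g: "continuous_map Z euclidean g" "\<And>z. z \<in> topspace Z \<Longrightarrow> (g z :: 'k) = f (\<tau> z)"
      using pull[OF f(1)] by blast
    let ?V = "{z \<in> topspace Z. 0 < norm (g z)}"
    have "openin Z ?V" by (rule openin_norm_gt[OF g(1)])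
    moreover have "z \<in> ?V" using z g f by simp
    moreover have "?V \<subseteq> {z \<in> topspace Z. \<tau> z \<in> U}" using g(2) f(3) by (metis (mono_tags, lifting) mem_Collect_eq norm_zero order_less_irrefl subsetI)
    ultimately show "\<exists>T. openin Z T \<and> z \<in> T \<and> T \<subseteq> {z \<in> topspace Z. \<tau> z \<in> U}" by blast
  qed
qed

lemma homeomorphic_if_C_0_isomorphic:
  fixes A :: "('k::real_normed_field, 'v) normed_alg" and Y :: "'y topology" and Z :: "'z topology"
  assumes A: "banach_algebra A"
    and lcY: "locally_compact_space Y" and HY: "Hausdorff_space Y"
    and isoY: "isometrically_isomorphic A (fun_alg Y (C_0 Y))"
    and lcZ: "locally_compact_space Z" and HZ: "Hausdorff_space Z"
    and isoZ: "isometrically_isomorphic A (fun_alg Z (C_0 Z))"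
  shows "Y homeomorphic_space Z"
proof -
  obtain \<phi> where \<phi>: "bij_betw \<phi> (carr A) (C_0 Y)"
      "\<And>a b. a \<in> carr A \<Longrightarrow> b \<in> carr A \<Longrightarrow> \<phi> (add A a b) = (\<lambda>y. \<phi> a y + \<phi> b y)"
      "\<And>a b. a \<in> carr A \<Longrightarrow> b \<in> carr A \<Longrightarrow> \<phi> (mult A a b) = (\<lambda>y. \<phi> a y * \<phi> b y)"
      "\<And>c a. a \<in> carr A \<Longrightarrow> \<phi> (scale A c a) = (\<lambda>y. c * \<phi> a y)"
      "\<And>a. a \<in> carr A \<Longrightarrow> sup_norm Y (\<phi> a) = nrm A a"
    using isoY unfolding isometrically_isomorphic_def by (auto simp: fun_alg_def)
  obtain \<psi> where \<psi>: "bij_betw \<psi> (carr A) (C_0 Z)"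
      "\<And>a b. a \<in> carr A \<Longrightarrow> b \<in> carr A \<Longrightarrow> \<psi> (add A a b) = (\<lambda>y. \<psi> a y + \<psi> b y)"
      "\<And>a b. a \<in> carr A \<Longrightarrow> b \<in> carr A \<Longrightarrow> \<psi> (mult A a b) = (\<lambda>y. \<psi> a y * \<psi> b y)"
      "\<And>c a. a \<in> carr A \<Longrightarrow> \<psi> (scale A c a) = (\<lambda>y. c * \<psi> a y)"
      "\<And>a. a \<in> carr A \<Longrightarrow> sup_norm Z (\<psi> a) = nrm A a"
    using isoZ unfolding isometrically_isomorphic_def by (auto simp: fun_alg_def)
  obtain \<tau> where \<tau>: "\<And>z. z \<in> topspace Z \<Longrightarrow> \<tau> z \<in> topspace Y"
      "\<And>z a. z \<in> topspace Z \<Longrightarrow> a \<in> carr A \<Longrightarrow> \<psi> a z = \<phi> a (\<tau> z)"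
    using isometric_copies_share_characters[OF A lcY HY lcZ HZ \<phi> \<psi>] by metis
  obtain \<sigma> where \<sigma>: "\<And>y. y \<in> topspace Y \<Longrightarrow> \<sigma> y \<in> topspace Z"
      "\<And>y a. y \<in> topspace Y \<Longrightarrow> a \<in> carr A \<Longrightarrow> \<phi> a y = \<psi> a (\<sigma> y)"
    using isometric_copies_share_characters[OF A lcZ HZ lcY HY \<psi> \<phi>] by metis
  have surj: "\<exists>a\<in>carr A. \<phi> a = f" if "f \<in> C_0 Y" for f
    using that bij_betw_imp_surj_on[OF \<phi>(1)] by (metis imageE)
  have surj': "\<exists>a\<in>carr A. \<psi> a = f" if "f \<in> C_0 Z" for f
    using that bij_betw_imp_surj_on[OF \<psi>(1)] by (metis imageE)
  have cont: "continuous_map Y euclidean (\<phi> a)" "continuous_map Z euclidean (\<psi> a)"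
    if "a \<in> carr A" for a
    using bij_betwE[OF \<phi>(1)] bij_betwE[OF \<psi>(1)] that C_b_continuous C_0_subset_C_b by blast+
  have sepY: "x = y" if xy: "x \<in> topspace Y" "y \<in> topspace Y" and eq: "\<And>a. a \<in> carr A \<Longrightarrow> \<phi> a x = \<phi> a y" for x y
  proof (rule ccontr)
    assume "x \<noteq> y"
    then obtain U where U: "openin Y U" "x \<in> U" "y \<notin> U"
      using HY xy unfolding Hausdorff_space_def disjnt_iff by blast
    obtain f :: "'y \<Rightarrow> 'k" where f: "f \<in> C_0 Y" "f x = 1" "\<And>w. w \<notin> U \<Longrightarrow> f w = 0"
      using C_0_separates[OF lcY HY U(1,2)] by blast
    then show False using surj[OF f(1)] eq f(3)[OF U(3)] by force
  qed
  have sepZ: "x = y" if xy: "x \<in> topspace Z" "y \<in> topspace Z" and eq: "\<And>a. a \<in> carr A \<Longrightarrow> \<psi> a x = \<psi> a y" for x y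
  proof (rule ccontr)
    assume "x \<noteq> y"
    then obtain U where U: "openin Z U" "x \<in> U" "y \<notin> U"
      using HZ xy unfolding Hausdorff_space_def disjnt_iff by blast
    obtain f :: "'z \<Rightarrow> 'k" where f: "f \<in> C_0 Z" "f x = 1" "\<And>w. w \<notin> U \<Longrightarrow> f w = 0"
      using C_0_separates[OF lcZ HZ U(1,2)] by blast
    then show False using surj'[OF f(1)] eq f(3)[OF U(3)] by force
  qed
  have "continuous_map Z Y \<tau>"
  proof (rule continuous_map_if_C_0_pullback[OF lcY HY \<tau>(1)])
    fix f :: "'y \<Rightarrow> 'k" assume "f \<in> C_0 Y"
    then obtain a where "a \<in> carr A" "\<phi> a = f" using surj by blast
    then show "\<exists>g. continuous_map Z euclidean g \<and> (\<forall>z\<in>topspace Z. g z = f (\<tau> z))"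
      using cont \<tau>(2) by blast
  qed
  moreover have "continuous_map Y Z \<sigma>"
  proof (rule continuous_map_if_C_0_pullback[OF lcZ HZ \<sigma>(1)])
    fix f :: "'z \<Rightarrow> 'k" assume "f \<in> C_0 Z"
    then obtain a where "a \<in> carr A" "\<psi> a = f" using surj' by blast
    then show "\<exists>g. continuous_map Y euclidean g \<and> (\<forall>z\<in>topspace Y. g z = f (\<sigma> z))"
      using cont \<sigma>(2) by blast
  qed
  moreover have "\<tau> (\<sigma> y) = y" if "y \<in> topspace Y" for y
    using that \<sigma> \<tau> by (intro sepY) metis+
  moreover have "\<sigma> (\<tau> z) = z" if "z \<in> topspace Z" for z
    using that \<sigma> \<tau> by (intro sepZ) metis+
  ultimately show ?thesis
    unfolding homeomorphic_space_def homeomorphic_maps_def by blast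
qed

section \<open>The Stone-Cech compactification\<close>

text \<open>Used to move a space to a type that its points can be encoded in.\<close>

lemma homeomorphic_copy_along_injection:
  assumes inj: "inj_on g (topspace T)"
  obtains B h where "homeomorphic_maps T B g h"
proof -
  define h where "h = inv_into (topspace T) g"
  have hg: "h (g x) = x" if "x \<in> topspace T" for x
    unfolding h_def using inj that by (rule inv_into_f_f)
  define B where "B = pullback_topology (g ` topspace T) h T"
  have topB: "topspace B = g ` topspace T"
    unfolding B_def topspace_pullback_topology using hg by auto
  have "continuous_map T B g"
    unfolding continuous_map_def
  proof (intro conjI allI impI)
    show "g \<in> topspace T \<rightarrow> topspace B" unfolding topB by auto
    fix U assume "openin B U"
    then obtain V where V: "openin T V" "U = h -` V \<inter> g ` topspace T"
      unfolding B_def openin_pullback_topology by blast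
    have "{x \<in> topspace T. g x \<in> U} = V"
    proof (intro equalityI subsetI)
      fix x assume "x \<in> {x \<in> topspace T. g x \<in> U}"
      then show "x \<in> V" using V(2) hg[of x] by simp
    next
      fix x assume "x \<in> V"
      then show "x \<in> {x \<in> topspace T. g x \<in> U}" using V openin_subset[OF V(1)] hg[of x] by auto
    qed
    then show "openin T {x \<in> topspace T. g x \<in> U}" using V by simp
  qed
  moreover have "continuous_map B T h"
    unfolding continuous_map_def
  proof (intro conjI allI impI)
    show "h \<in> topspace B \<rightarrow> topspace T" unfolding topB using hg by auto
    fix V assume V: "openin T V"
    have "{y \<in> topspace B. h y \<in> V} = h -` V \<inter> g ` topspace T" unfolding topB by auto
    then show "openin B {y \<in> topspace B. h y \<in> V}"
      unfolding B_def openin_pullback_topology using V by blast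
  qed
  ultimately have "homeomorphic_maps T B g h"
    unfolding homeomorphic_maps_def topB using hg by auto
  then show thesis by (rule that)
qed

text \<open>The compactification is described by its universal property for functions into the unit interval,
with \<open>e\<close> the canonical map from \<open>X\<close>.\<close>

locale stone_cech =
  fixes X :: "'a topology" and B :: "'b topology" and e :: "'a \<Rightarrow> 'b"
  assumes compact: "compact_space B" and Hausdorff: "Hausdorff_space B"
    and continuous_e: "continuous_map X B e"
    and dense: "B closure_of (e ` topspace X) = topspace B"
    and extension_unit: "continuous_map X (top_of_set {0..1::real}) f \<Longrightarrow>
      \<exists>F. continuous_map B euclidean F \<and> (\<forall>x\<in>topspace X. F (e x) = f x)"

text \<open>The closure of the image of \<open>X\<close> in the cube \<open>[0,1]\<^sup>I\<close>, where \<open>I\<close> consists of all continuous functions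
into the unit interval; extensions are coordinate projections. A point \<open>y\<close> of the closure is determined
by the family of those subsets of \<open>X\<close> whose image has \<open>y\<close> in its closure, because \<open>y\<close> lies in the
closure of the part of the image in any of its neighbourhoods. So the space can be carried by families
of subsets of \<open>X\<close>.\<close>

lemma stone_cech_exists:
  fixes X :: "'a topology"
  shows "\<exists>(B :: 'a set set topology) e. stone_cech X B e"
proof -
  define I where "I = {f. continuous_map X (top_of_set {0..1::real}) f}"
  define P where "P = product_topology (\<lambda>_. top_of_set {0..1::real}) I"
  have cP: "compact_space P"
    unfolding P_def by (auto simp: compact_space_product_topology compact_space_subtopology)
  have HP: "Hausdorff_space P"
    unfolding P_def by (auto simp: Hausdorff_space_product_topology intro!: Hausdorff_space_subtopology)
  define \<epsilon> where "\<epsilon> = (\<lambda>x. \<lambda>f\<in>I. f x)"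
  have c\<epsilon>: "continuous_map X P \<epsilon>"
    unfolding P_def \<epsilon>_def by (auto simp: continuous_map_componentwise I_def)
  define S where "S = P closure_of (\<epsilon> ` topspace X)"
  define T where "T = subtopology P S"
  have sub: "\<epsilon> ` topspace X \<subseteq> S"
    unfolding S_def by (rule closure_of_subset) (use c\<epsilon> in \<open>simp add: continuous_map_image_subset_topspace\<close>)
  have topT: "topspace T = S"
    unfolding T_def S_def by (rule topspace_subtopology_subset[OF closure_of_subset_topspace])
  have cT: "compact_space T"
    unfolding T_def S_def by (intro compact_space_subtopology closedin_compact_space cP closedin_closure_of)
  have HT: "Hausdorff_space T" unfolding T_def by (rule Hausdorff_space_subtopology[OF HP])
  have c\<epsilon>T: "continuous_map X T \<epsilon>"
    unfolding T_def using c\<epsilon> sub by (auto simp: continuous_map_in_subtopology)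
  have dT: "T closure_of (\<epsilon> ` topspace X) = topspace T"
    unfolding topT unfolding T_def closure_of_subtopology using sub
    by (simp add: Int_absorb1 S_def)
  define g where "g = (\<lambda>y. {A. A \<subseteq> topspace X \<and> y \<in> T closure_of (\<epsilon> ` A)})"
  have "inj_on g (topspace T)"
  proof (rule inj_onI, rule ccontr)
    fix y z assume y: "y \<in> topspace T" and z: "z \<in> topspace T" and eq: "g y = g z" and ne: "y \<noteq> z"
    obtain U V where UV: "openin T U" "openin T V" "y \<in> U" "z \<in> V" "disjnt U V"
      using HT y z ne unfolding Hausdorff_space_def by blast
    define A where "A = {x \<in> topspace X. \<epsilon> x \<in> U}"
    have "U \<inter> \<epsilon> ` topspace X = \<epsilon> ` A" unfolding A_def by auto
    then have "y \<in> T closure_of (\<epsilon> ` A)"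
      using openin_Int_closure_of_subset[OF UV(1), of "\<epsilon> ` topspace X"] y UV(3) dT by auto
    then have "A \<in> g y" unfolding g_def A_def by simp
    then have "z \<in> T closure_of (\<epsilon> ` A)" unfolding eq unfolding g_def by simp
    then obtain w where "w \<in> \<epsilon> ` A" "w \<in> V" using UV unfolding in_closure_of by blast
    then show False using UV(5) unfolding A_def disjnt_def by blast
  qed
  then obtain B h where hom: "homeomorphic_maps T B g h"
    by (rule homeomorphic_copy_along_injection)
  then have hs: "T homeomorphic_space B" and hm: "homeomorphic_map T B g"
    unfolding homeomorphic_space_def using homeomorphic_maps_map by blast+
  have gc: "continuous_map T B g" and hc: "continuous_map B T h"
    and hg: "\<And>x. x \<in> topspace T \<Longrightarrow> h (g x) = x"
    using hom unfolding homeomorphic_maps_def by auto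
  have "stone_cech X B (g \<circ> \<epsilon>)"
  proof
    show "compact_space B" using cT hs homeomorphic_compact_space by blast
    show "Hausdorff_space B" using HT hs homeomorphic_Hausdorff_space by blast
    show "continuous_map X B (g \<circ> \<epsilon>)" using c\<epsilon>T gc by (rule continuous_map_compose)
    have "B closure_of (g ` (\<epsilon> ` topspace X)) = g ` (T closure_of (\<epsilon> ` topspace X))"
      by (rule homeomorphic_map_closure_of[OF hm]) (use sub topT in simp)
    then show "B closure_of ((g \<circ> \<epsilon>) ` topspace X) = topspace B"
      using homeomorphic_imp_surjective_map[OF hm] by (simp add: dT image_comp)
    fix f :: "'a \<Rightarrow> real" assume f: "continuous_map X (top_of_set {0..1}) f"
    then have fI: "f \<in> I" unfolding I_def by simp
    have "continuous_map P (top_of_set {0..1::real}) (\<lambda>y. y f)"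
      unfolding P_def using fI by (rule continuous_map_product_projection)
    then have "continuous_map P euclidean (\<lambda>y. y f)" by (simp add: continuous_map_in_subtopology)
    then have "continuous_map T euclidean (\<lambda>y. y f)"
      unfolding T_def by (rule continuous_map_from_subtopology)
    then have "continuous_map B euclidean (\<lambda>y. h y f)"
      using continuous_map_compose[OF hc] by (simp add: o_def)
    moreover have "\<forall>x\<in>topspace X. h ((g \<circ> \<epsilon>) x) f = f x"
      using hg sub topT fI by (auto simp: \<epsilon>_def)
    ultimately show "\<exists>F. continuous_map B euclidean F \<and> (\<forall>x\<in>topspace X. F ((g \<circ> \<epsilon>) x) = f x)"
      by blast
  qed
  then show ?thesis by blast
qed

context stone_cech
begin

lemma e_in: "x \<in> topspace X \<Longrightarrow> e x \<in> topspace B"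
  using continuous_map_image_subset_topspace[OF continuous_e] by blast

text \<open>Each coordinate of a bounded function can be rescaled affinely into the unit interval.\<close>

lemma extension_C_b:
  fixes f :: "'a \<Rightarrow> 'k::{real_normed_field,euclidean_space}"
  assumes f: "f \<in> C_b X"
  shows "\<exists>F. continuous_map B euclidean F \<and> (\<forall>x\<in>topspace X. F (e x) = f x)"
proof -
  define M where "M = sup_norm X f + 1"
  have M: "M > 0" "\<And>x. norm (f x) \<le> M"
    unfolding M_def using sup_norm_nonneg[OF f] norm_le_sup_norm[OF f] by (auto intro: add_increasing2)
  have "\<exists>G. continuous_map B euclidean G \<and> (\<forall>x\<in>topspace X. G (e x) = (f x \<bullet> b + M) / (2 * M))"
    if b: "b \<in> Basis" for b
  proof (rule extension_unit)
    have "continuous_map X euclidean (\<lambda>x. (f x \<bullet> b + M) / (2 * M))"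
      using C_b_continuous[OF f] M(1) unfolding continuous_map_euclidean_iff_tendsto
      by (auto intro!: tendsto_intros)
    moreover have "(f x \<bullet> b + M) / (2 * M) \<in> {0..1}" for x
    proof -
      have "\<bar>f x \<bullet> b\<bar> \<le> M" using Basis_le_norm[OF b, of "f x"] M(2)[of x] by linarith
      then show ?thesis using M(1) by (auto simp: field_simps)
    qed
    ultimately show "continuous_map X (top_of_set {0..1}) (\<lambda>x. (f x \<bullet> b + M) / (2 * M))"
      by (auto simp: continuous_map_in_subtopology)
  qed
  then obtain G where G: "\<And>b. b \<in> Basis \<Longrightarrow> continuous_map B euclidean (G b)"
    "\<And>b x. b \<in> Basis \<Longrightarrow> x \<in> topspace X \<Longrightarrow> G b (e x) = (f x \<bullet> b + M) / (2 * M)"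
    by metis
  define F where "F = (\<lambda>y. \<Sum>b\<in>Basis. (2 * M * G b y - M) *\<^sub>R b)"
  have "continuous_map B euclidean F"
    unfolding continuous_map_euclidean_iff_tendsto F_def
    using G(1) unfolding continuous_map_euclidean_iff_tendsto
    by (auto intro!: tendsto_sum tendsto_scaleR tendsto_diff tendsto_mult_left)
  moreover have "F (e x) = f x" if x: "x \<in> topspace X" for x
  proof -
    have "F (e x) = (\<Sum>b\<in>Basis. (f x \<bullet> b) *\<^sub>R b)"
      unfolding F_def by (rule sum.cong) (use G(2)[OF _ x] M(1) in auto)
    then show ?thesis by (simp add: euclidean_representation)
  qed
  ultimately show ?thesis by blast
qed

definition hat :: "'a set \<Rightarrow> 'b set" where
  "hat U = B closure_of (e ` U)"

lemma hat_mono: "U \<subseteq> V \<Longrightarrow> hat U \<subseteq> hat V"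
  unfolding hat_def by (intro closure_of_mono image_mono)

lemma hat_Un: "hat (U \<union> V) = hat U \<union> hat V"
  unfolding hat_def by (simp add: image_Un)

lemma hat_empty [simp]: "hat {} = {}"
  unfolding hat_def by simp

lemma hat_topspace: "hat (topspace X) = topspace B"
  unfolding hat_def by (rule dense)

lemma closedin_hat: "closedin B (hat U)"
  unfolding hat_def by (rule closedin_closure_of)

lemma e_in_hat: "x \<in> topspace X \<Longrightarrow> x \<in> U \<Longrightarrow> e x \<in> hat U"
  unfolding hat_def using e_in by (auto simp: in_closure_of)

lemma extension_constant_on_hat:
  assumes F: "continuous_map B euclidean (F :: 'b \<Rightarrow> 'k::real_normed_vector)"
    and c: "\<And>x. x \<in> U \<Longrightarrow> F (e x) = c" and y: "y \<in> hat U"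
  shows "F y = c"
  using y unfolding hat_def
proof (rule forall_in_closure_of)
  show "closedin B {y \<in> topspace B. F y = c}"
    using closedin_continuous_map_preimage[OF F, of "{c}"] by simp
qed (use c in auto)

text \<open>The indicator function of \<open>U\<close> is continuous, and its extension separates the two closures.\<close>

lemma hat_disjoint:
  assumes U: "openin X U" "closedin X U" and "U \<inter> V = {}" and V: "V \<subseteq> topspace X"
  shows "hat U \<inter> hat V = {}"
proof -
  define f where "f = (\<lambda>x. if x \<in> U then 1 else 0 :: real)"
  have "continuous_map X (top_of_set {0..1}) f"
    unfolding continuous_map_def
  proof (intro conjI allI impI)
    show "f \<in> topspace X \<rightarrow> topspace (top_of_set {0..1})" unfolding f_def by auto
    fix W :: "real set"
    have sub: "U \<subseteq> topspace X" using U openin_subset by blast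
    have "{x \<in> topspace X. f x \<in> W} = (if 1 \<in> W then U else {}) \<union> (if 0 \<in> W then topspace X - U else {})"
      unfolding f_def using sub by auto
    then show "openin X {x \<in> topspace X. f x \<in> W}"
      using U by (auto intro!: openin_Un openin_diff)
  qed
  then obtain F where F: "continuous_map B euclidean F" "\<And>x. x \<in> topspace X \<Longrightarrow> F (e x) = f x"
    using extension_unit by blast
  have "F y = 1" if "y \<in> hat U" for y
    by (rule extension_constant_on_hat[OF F(1) _ that])
      (use F(2) openin_subset[OF U(1)] in \<open>auto simp: f_def\<close>)
  moreover have "F y = 0" if "y \<in> hat V" for y
  proof (rule extension_constant_on_hat[OF F(1) _ that])
    fix x assume "x \<in> V"
    then have "x \<in> topspace X" "x \<notin> U" using V assms(3) by blast+
    then show "F (e x) = 0" using F(2) by (simp add: f_def)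
  qed
  ultimately show ?thesis by fastforce
qed

lemma hat_Compl:
  assumes "openin X U" "closedin X U"
  shows "hat (topspace X - U) = topspace B - hat U"
proof -
  have sub: "U \<subseteq> topspace X" using assms openin_subset by blast
  have "hat U \<union> hat (topspace X - U) = topspace B"
    unfolding hat_Un[symmetric] using sub hat_topspace by (simp add: Un_absorb1)
  moreover have "hat U \<inter> hat (topspace X - U) = {}"
    using assms by (intro hat_disjoint) auto
  ultimately show ?thesis by auto
qed

lemma openin_hat:
  assumes "openin X U" "closedin X U"
  shows "openin B (hat U)"
proof -
  have "topspace B - hat (topspace X - U) = hat U"
    using hat_Compl[OF assms] closedin_subset[OF closedin_hat] by auto
  then show ?thesis using closedin_hat[of "topspace X - U"] by (metis closedin_def)
qed

lemma e_in_hat_iff: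
  assumes "openin X U" "closedin X U" "x \<in> topspace X"
  shows "e x \<in> hat U \<longleftrightarrow> x \<in> U"
  using e_in_hat[OF assms(3)] hat_Compl[OF assms(1,2)] assms(3) by blast

lemma hat_Int:
  assumes U: "openin X U" "closedin X U" and V: "openin X V" "closedin X V"
  shows "hat (U \<inter> V) = hat U \<inter> hat V"
proof
  show "hat (U \<inter> V) \<subseteq> hat U \<inter> hat V" by (simp add: hat_mono)
  have "hat U = hat (U \<inter> V) \<union> hat (U - V)"
    unfolding hat_Un[symmetric] by (simp add: Int_Diff_Un)
  moreover have "hat V \<inter> hat (U - V) = {}"
    using V openin_subset[OF U(1)] by (intro hat_disjoint) auto
  ultimately show "hat U \<inter> hat V \<subseteq> hat (U \<inter> V)" by auto
qed

end

section \<open>The union of the closures of separable clopen sets\<close>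

text \<open>From here on \<open>X\<close> is the topological sum of the members of \<open>\<P>\<close>, so every subfamily has a clopen
union.\<close>

locale clopen_pieces = stone_cech X B e
  for X :: "'a topology" and B :: "'b topology" and e :: "'a \<Rightarrow> 'b" +
  fixes \<P> :: "'a set set"
  assumes Union_pieces: "\<Union>\<P> = topspace X"
    and disjoint_pieces: "disjoint \<P>"
    and open_pieces: "U \<in> \<P> \<Longrightarrow> openin X U"
begin

lemma piece_unique: "U \<in> \<P> \<Longrightarrow> V \<in> \<P> \<Longrightarrow> x \<in> U \<Longrightarrow> x \<in> V \<Longrightarrow> U = V"
  using disjointD[OF disjoint_pieces, of U V] by blast

lemma pieces_Int:
  assumes "S \<subseteq> \<P>" "T \<subseteq> \<P>" shows "\<Union>S \<inter> \<Union>T = \<Union>(S \<inter> T)"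
proof
  show "\<Union>S \<inter> \<Union>T \<subseteq> \<Union>(S \<inter> T)"
  proof
    fix x assume "x \<in> \<Union>S \<inter> \<Union>T"
    then obtain U V where UV: "U \<in> S" "x \<in> U" "V \<in> T" "x \<in> V" by blast
    then have "U = V" using piece_unique assms by blast
    then show "x \<in> \<Union>(S \<inter> T)" using UV by blast
  qed
qed blast

lemma pieces_Diff:
  assumes "S \<subseteq> \<P>" shows "\<Union>(\<P> - S) = topspace X - \<Union>S"
proof -
  have "\<Union>\<P> = \<Union>S \<union> \<Union>(\<P> - S)" using assms by blast
  moreover have "\<Union>S \<inter> \<Union>(\<P> - S) = {}" using pieces_Int[of S "\<P> - S"] assms by simp
  ultimately show ?thesis using Union_pieces by blast
qed

lemma openin_Union_pieces: "S \<subseteq> \<P> \<Longrightarrow> openin X (\<Union>S)"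
  using open_pieces by (intro openin_Union) auto

lemma closedin_Union_pieces:
  assumes "S \<subseteq> \<P>" shows "closedin X (\<Union>S)"
  using openin_Union_pieces[of "\<P> - S"] pieces_Diff[OF assms] openin_subset[OF openin_Union_pieces[OF assms]]
  by (auto simp: closedin_def)

text \<open>Together with \<open>Hat_Int\<close> and \<open>Hat_Compl\<close>, this makes subfamilies of \<open>\<P>\<close> into a Boolean algebra of
clopen subsets of \<open>B\<close>.\<close>

definition Hat :: "'a set set \<Rightarrow> 'b set" where
  "Hat S = hat (\<Union>S)"

lemma Hat_mono: "S \<subseteq> T \<Longrightarrow> Hat S \<subseteq> Hat T"
  unfolding Hat_def by (intro hat_mono Union_mono)

lemma Hat_empty [simp]: "Hat {} = {}"
  unfolding Hat_def by simp

lemma Hat_Int: "S \<subseteq> \<P> \<Longrightarrow> T \<subseteq> \<P> \<Longrightarrow> Hat S \<inter> Hat T = Hat (S \<inter> T)"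
  unfolding Hat_def
  by (simp add: pieces_Int hat_Int[symmetric] openin_Union_pieces closedin_Union_pieces)

lemma Hat_Compl: "S \<subseteq> \<P> \<Longrightarrow> Hat (\<P> - S) = topspace B - Hat S"
  unfolding Hat_def by (simp add: pieces_Diff hat_Compl openin_Union_pieces closedin_Union_pieces)

lemma openin_Hat: "S \<subseteq> \<P> \<Longrightarrow> openin B (Hat S)"
  unfolding Hat_def by (intro openin_hat openin_Union_pieces closedin_Union_pieces)

lemma closedin_Hat: "closedin B (Hat S)"
  unfolding Hat_def by (rule closedin_hat)

lemma compactin_Hat: "compactin B (Hat S)"
  using closedin_compact_space[OF compact closedin_Hat] .

lemma e_in_Hat_iff: "S \<subseteq> \<P> \<Longrightarrow> x \<in> topspace X \<Longrightarrow> e x \<in> Hat S \<longleftrightarrow> x \<in> \<Union>S"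
  unfolding Hat_def by (intro e_in_hat_iff openin_Union_pieces closedin_Union_pieces)

text \<open>The points of the compactification that are concentrated on countably many pieces.\<close>

definition core :: "'b set" where
  "core = \<Union>(Hat ` {C. countable C \<and> C \<subseteq> \<P>})"

definition Y :: "'b topology" where
  "Y = subtopology B core"

lemma Hat_subset_core: "countable C \<Longrightarrow> C \<subseteq> \<P> \<Longrightarrow> Hat C \<subseteq> core"
  unfolding core_def by blast

lemma openin_core: "openin B core"
  unfolding core_def using openin_Hat by blast

lemma topspace_Y: "topspace Y = core"
  unfolding Y_def using openin_subset[OF openin_core] by (simp add: Int_absorb1)

lemma e_in_core:
  assumes x: "x \<in> topspace X" shows "e x \<in> core"
proof -
  obtain U where "U \<in> \<P>" "x \<in> U" using x Union_pieces by blast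
  then show ?thesis using Hat_subset_core[of "{U}"] e_in_Hat_iff[of "{U}" x] x by auto
qed

lemma openin_Y_Hat: "countable C \<Longrightarrow> C \<subseteq> \<P> \<Longrightarrow> openin Y (Hat C)"
  unfolding Y_def using openin_Hat Hat_subset_core openin_core by (simp add: openin_open_subtopology)

lemma compactin_Y_Hat: "countable C \<Longrightarrow> C \<subseteq> \<P> \<Longrightarrow> compactin Y (Hat C)"
  unfolding Y_def compactin_subtopology using compactin_Hat Hat_subset_core by blast

text \<open>A countable union of countable families of pieces is again such a family. Countable compactness of
\<open>Y\<close> rests on this.\<close>

lemma countable_subset_core_in_Hat:
  assumes "countable A" "A \<subseteq> core"
  obtains C where "countable C" "C \<subseteq> \<P>" "A \<subseteq> Hat C"
proof -
  have "\<forall>y\<in>A. \<exists>C. countable C \<and> C \<subseteq> \<P> \<and> y \<in> Hat C"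
    using assms(2) unfolding core_def by blast
  then obtain c where c: "\<And>y. y \<in> A \<Longrightarrow> countable (c y) \<and> c y \<subseteq> \<P> \<and> y \<in> Hat (c y)"
    by metis
  show thesis
  proof (rule that[of "\<Union>(c ` A)"])
    show "countable (\<Union>(c ` A))" using assms(1) c by (intro countable_UN) auto
    show "\<Union>(c ` A) \<subseteq> \<P>" using c by blast
    show "A \<subseteq> Hat (\<Union>(c ` A))"
    proof
      fix y assume y: "y \<in> A"
      then have "Hat (c y) \<subseteq> Hat (\<Union>(c ` A))" by (intro Hat_mono) blast
      then show "y \<in> Hat (\<Union>(c ` A))" using c[OF y] by blast
    qed
  qed
qed

text \<open>The sets \<open>Hat C\<close> form a directed open cover of \<open>Y\<close>.\<close>

lemma compactin_Y_in_Hat: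
  assumes K: "compactin Y K"
  obtains C where "countable C" "C \<subseteq> \<P>" "K \<subseteq> Hat C"
proof -
  have "K \<subseteq> \<Union>(Hat ` {C. countable C \<and> C \<subseteq> \<P>})"
    using compactin_subset_topspace[OF K] topspace_Y unfolding core_def by simp
  then obtain \<F> where \<F>: "finite \<F>" "\<F> \<subseteq> Hat ` {C. countable C \<and> C \<subseteq> \<P>}" "K \<subseteq> \<Union>\<F>"
    using compactinD[OF K, of "Hat ` {C. countable C \<and> C \<subseteq> \<P>}"] openin_Y_Hat by blast
  then obtain T where T: "finite T" "T \<subseteq> {C. countable C \<and> C \<subseteq> \<P>}" "\<F> = Hat ` T"
    by (meson finite_subset_image)
  show thesis
  proof (rule that[of "\<Union>T"])
    have "countable (\<Union>C\<in>T. C)" using countable_finite[OF T(1)] T(2) by (intro countable_UN) auto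
    then show "countable (\<Union>T)" by simp
    show "\<Union>T \<subseteq> \<P>" using T(2) by blast
    have "Hat C \<subseteq> Hat (\<Union>T)" if "C \<in> T" for C using that by (intro Hat_mono) blast
    then show "K \<subseteq> Hat (\<Union>T)" using \<F>(3) T(3) by blast
  qed
qed

lemma Hausdorff_Y: "Hausdorff_space Y"
  unfolding Y_def by (rule Hausdorff_space_subtopology[OF Hausdorff])

lemma locally_compact_Y: "locally_compact_space Y"
  unfolding Y_def
  using locally_compact_space_open_subset[OF _ compact_imp_locally_compact_space[OF compact] openin_core] Hausdorff
  by blast

text \<open>Were there no finite subcover, each of the countably many finite subfamilies would miss a point. All
these points lie in one compact set \<open>Hat C\<close>, which a finite subfamily does cover.\<close>

lemma countably_compact_Y: "countably_compact_space Y"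
  unfolding countably_compact_space_def
proof (intro allI impI)
  fix \<U> assume \<U>: "countable \<U> \<and> (\<forall>U\<in>\<U>. openin Y U) \<and> topspace Y \<subseteq> \<Union>\<U>"
  show "\<exists>\<F>. finite \<F> \<and> \<F> \<subseteq> \<U> \<and> topspace Y \<subseteq> \<Union>\<F>"
  proof (rule ccontr)
    assume contra: "\<not> ?thesis"
    have "\<exists>y. y \<in> topspace Y - \<Union>\<F>" if "\<F> \<in> Collect finite \<inter> Pow \<U>" for \<F>
      using contra that by blast
    then obtain y where y: "\<And>\<F>. \<F> \<in> Collect finite \<inter> Pow \<U> \<Longrightarrow> y \<F> \<in> topspace Y - \<Union>\<F>"
      by metis
    have "countable (Collect finite \<inter> Pow \<U>)"
      using countable_Collect_finite_subset[of \<U>] \<U> by (simp add: Collect_conj_eq Pow_def)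
    then have "countable (y ` (Collect finite \<inter> Pow \<U>))" by (rule countable_image)
    moreover have "y ` (Collect finite \<inter> Pow \<U>) \<subseteq> core"
      using y unfolding topspace_Y by blast
    ultimately obtain C where C: "countable C" "C \<subseteq> \<P>" "y ` (Collect finite \<inter> Pow \<U>) \<subseteq> Hat C"
      by (rule countable_subset_core_in_Hat)
    have "Hat C \<subseteq> \<Union>\<U>" using \<U> Hat_subset_core[OF C(1,2)] topspace_Y by blast
    then obtain \<F> where "finite \<F>" "\<F> \<subseteq> \<U>" "Hat C \<subseteq> \<Union>\<F>"
      using compactinD[OF compactin_Y_Hat[OF C(1,2)], of \<U>] \<U> by blast
    then show False using y[of \<F>] C(3) by blast
  qed
qed

lemma dense_Y: "Y closure_of (e ` topspace X) = topspace Y"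
proof -
  have "e ` topspace X \<subseteq> core" using e_in_core by blast
  then show ?thesis
    unfolding topspace_Y unfolding Y_def closure_of_subtopology
    using openin_subset[OF openin_core] by (simp add: Int_absorb1 Int_absorb2 dense)
qed

lemma continuous_e_Y: "continuous_map X Y e"
  unfolding Y_def continuous_map_in_subtopology using continuous_e e_in_core by auto

text \<open>The bound holds on the dense image of \<open>X\<close>.\<close>

lemma norm_le_on_Y:
  assumes F: "continuous_map Y euclidean (F :: 'b \<Rightarrow> 'k::real_normed_field)"
    and le: "\<And>x. x \<in> topspace X \<Longrightarrow> norm (F (e x)) \<le> c" and y: "y \<in> topspace Y"
  shows "norm (F y) \<le> c"
proof (rule forall_in_closure_of[where X = Y and S = "e ` topspace X"])
  show "y \<in> Y closure_of (e ` topspace X)" using y dense_Y by simp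
  have "continuous_map Y euclidean (\<lambda>y. norm (F y))"
    using F unfolding continuous_map_euclidean_iff_tendsto by (auto intro: tendsto_norm)
  then have "closedin Y {y \<in> topspace Y. norm (F y) \<in> {..c}}"
    by (rule closedin_continuous_map_preimage) simp
  then show "closedin Y {y \<in> topspace Y. norm (F y) \<le> c}" by simp
qed (use le in auto)

text \<open>The cozero set is the union of countably many compact level sets.\<close>

lemma C_0_Y_vanishes_off_Hat:
  fixes F :: "'b \<Rightarrow> 'k::real_normed_field"
  assumes F: "F \<in> C_0 Y"
  shows "\<exists>C. countable C \<and> C \<subseteq> \<P> \<and> (\<forall>y. y \<notin> Hat C \<longrightarrow> F y = 0)"
proof -
  define K where "K = (\<lambda>n. {y \<in> topspace Y. inverse (real (Suc n)) \<le> norm (F y)})"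
  have "\<exists>C. countable C \<and> C \<subseteq> \<P> \<and> K n \<subseteq> Hat C" for n
  proof -
    have "0 < inverse (real (Suc n))" by simp
    then have "compactin Y (K n)" using F unfolding C_0_def K_def by blast
    then show ?thesis by (metis compactin_Y_in_Hat)
  qed
  then obtain c where c: "\<And>n. countable (c n) \<and> c n \<subseteq> \<P> \<and> K n \<subseteq> Hat (c n)"
    by metis
  show ?thesis
  proof (intro exI[of _ "\<Union>n. c n"] conjI allI impI)
    show "countable (\<Union>n. c n)" using c by (intro countable_UN) auto
    show "(\<Union>n. c n) \<subseteq> \<P>" using c by blast
    fix y assume y: "y \<notin> Hat (\<Union>n. c n)"
    show "F y = 0"
    proof (rule ccontr)
      assume nz: "F y \<noteq> 0"
      then have "y \<in> topspace Y" using C_b_outside[OF C_0_subset_C_b[OF F]] by blast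
      moreover obtain n where "inverse (real (Suc n)) < norm (F y)"
        using reals_Archimedean[of "norm (F y)"] nz by auto
      ultimately have "y \<in> K n" unfolding K_def by auto
      moreover have "Hat (c n) \<subseteq> Hat (\<Union>n. c n)" by (intro Hat_mono) blast
      ultimately show False using c y by blast
    qed
  qed
qed

text \<open>The support of a function in \<open>C_0 Y\<close> is a closed subset of a single compact set \<open>Hat C\<close>.\<close>

lemma C_0_Y_eq_C_00: "(C_0 Y :: ('b \<Rightarrow> 'k::real_normed_field) set) = C_00 Y"
proof (intro equalityI subsetI)
  fix F :: "'b \<Rightarrow> 'k" assume F: "F \<in> C_0 Y"
  obtain C where C: "countable C" "C \<subseteq> \<P>" "\<And>y. y \<notin> Hat C \<Longrightarrow> F y = 0"
    using C_0_Y_vanishes_off_Hat[OF F] by blast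
  have "closedin Y (Hat C)"
    using compactin_imp_closedin[OF Hausdorff_Y compactin_Y_Hat[OF C(1,2)]] .
  moreover have "Coz Y F \<subseteq> Hat C" unfolding Coz_def using C(3) by blast
  ultimately have "supp Y F \<subseteq> Hat C" unfolding supp_def by (simp add: closure_of_minimal)
  then have "compactin Y (supp Y F)"
    using closed_compactin[OF compactin_Y_Hat[OF C(1,2)]] closedin_closure_of unfolding supp_def by blast
  then show "F \<in> C_00 Y" unfolding C_00_def using C_0_subset_C_b[OF F] by simp
next
  fix F :: "'b \<Rightarrow> 'k" assume F: "F \<in> C_00 Y"
  then have Fb: "F \<in> C_b Y" and K: "compactin Y (supp Y F)" unfolding C_00_def by auto
  have sub: "Coz Y F \<subseteq> supp Y F"
    unfolding supp_def by (rule closure_of_subset) (auto simp: Coz_def)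
  show "F \<in> C_0 Y"
    unfolding C_0_def
  proof (intro CollectI conjI Fb allI impI)
    fix \<epsilon> :: real assume "\<epsilon> > 0"
    then have "{y \<in> topspace Y. \<epsilon> \<le> norm (F y)} \<subseteq> Coz Y F" unfolding Coz_def by auto
    then show "compactin Y {y \<in> topspace Y. \<epsilon> \<le> norm (F y)}"
      using closed_compactin[OF K _ closedin_norm_ge[OF C_b_continuous[OF Fb]]] sub by blast
  qed
qed

definition C_countable :: "('a \<Rightarrow> 'k::real_normed_field) set" where
  "C_countable = {f \<in> C_b X. \<exists>C. countable C \<and> C \<subseteq> \<P> \<and> Coz X f \<subseteq> \<Union>C}"

text \<open>The extension to \<open>B\<close> vanishes on the closure of the pieces outside \<open>C\<close>, which is the complement of
\<open>Hat C\<close>. Its level sets in \<open>Y\<close> are therefore closed subsets of the compact set \<open>Hat C\<close>.\<close>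

lemma C_countable_extends:
  fixes f :: "'a \<Rightarrow> 'k::{real_normed_field,euclidean_space}"
  assumes "f \<in> C_countable"
  shows "\<exists>F\<in>C_0 Y. \<forall>x\<in>topspace X. F (e x) = f x"
proof -
  from assms obtain C where f: "f \<in> C_b X" and C: "countable C" "C \<subseteq> \<P>" "Coz X f \<subseteq> \<Union>C"
    unfolding C_countable_def by blast
  obtain G where G: "continuous_map B euclidean G" "\<And>x. x \<in> topspace X \<Longrightarrow> G (e x) = f x"
    using extension_C_b[OF f] by blast
  have G0: "G y = 0" if "y \<in> topspace B" "y \<notin> Hat C" for y
  proof (rule extension_constant_on_hat[OF G(1)])
    show "y \<in> hat (\<Union>(\<P> - C))" using Hat_Compl[OF C(2)] that unfolding Hat_def by blast
    fix x assume "x \<in> \<Union>(\<P> - C)"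
    then show "G (e x) = 0"
      unfolding pieces_Diff[OF C(2)] using G(2) C(3) unfolding Coz_def by auto
  qed
  define F where "F = (\<lambda>y. if y \<in> topspace Y then G y else 0)"
  have contG: "continuous_map Y euclidean G"
    unfolding Y_def by (rule continuous_map_from_subtopology[OF G(1)])
  have Fe: "F (e x) = f x" if "x \<in> topspace X" for x
    unfolding F_def topspace_Y using e_in_core[OF that] G(2)[OF that] by simp
  have Fb: "F \<in> C_b Y"
  proof (rule C_b_I)
    show contF: "continuous_map Y euclidean F"
      by (rule continuous_map_eq[OF contG]) (simp add: F_def)
    show "norm (F y) \<le> sup_norm X f" if "y \<in> topspace Y" for y
      using norm_le_on_Y[OF contF _ that] Fe norm_le_sup_norm[OF f] by simp
  qed (simp add: F_def)
  have F0: "y \<in> Hat C" if "F y \<noteq> 0" for y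
  proof (rule ccontr)
    assume "y \<notin> Hat C"
    moreover have "y \<in> topspace Y" "G y \<noteq> 0" using that unfolding F_def by (auto split: if_splits)
    ultimately show False using G0[of y] openin_subset[OF openin_core] topspace_Y by blast
  qed
  have "F \<in> C_0 Y"
    unfolding C_0_def
  proof (intro CollectI conjI Fb allI impI)
    fix \<epsilon> :: real assume "\<epsilon> > 0"
    have "{y \<in> topspace Y. \<epsilon> \<le> norm (F y)} \<subseteq> Hat C"
    proof
      fix y assume "y \<in> {y \<in> topspace Y. \<epsilon> \<le> norm (F y)}"
      then have "F y \<noteq> 0" using \<open>\<epsilon> > 0\<close> by auto
      then show "y \<in> Hat C" by (rule F0)
    qed
    then show "compactin Y {y \<in> topspace Y. \<epsilon> \<le> norm (F y)}"
      using closed_compactin[OF compactin_Y_Hat[OF C(1,2)] _ closedin_norm_ge[OF C_b_continuous[OF Fb]]]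
      by blast
  qed
  then show ?thesis using Fe by blast
qed

lemma C_0_Y_restricts:
  fixes F :: "'b \<Rightarrow> 'k::real_normed_field"
  assumes F: "F \<in> C_0 Y"
  shows "(\<lambda>x. if x \<in> topspace X then F (e x) else 0) \<in> C_countable"
proof -
  let ?f = "\<lambda>x. if x \<in> topspace X then F (e x) else 0"
  have Fb: "F \<in> C_b Y" by (rule C_0_subset_C_b[OF F])
  have "?f \<in> C_b X"
  proof (rule C_b_I)
    have "continuous_map X euclidean (F \<circ> e)"
      using continuous_e_Y C_b_continuous[OF Fb] by (rule continuous_map_compose)
    then show "continuous_map X euclidean ?f"
      by (rule continuous_map_eq) simp
    show "norm (?f x) \<le> sup_norm Y F" if "x \<in> topspace X" for x
      using norm_le_sup_norm[OF Fb] that by simp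
  qed simp
  moreover obtain C where C: "countable C" "C \<subseteq> \<P>" "\<And>y. y \<notin> Hat C \<Longrightarrow> F y = 0"
    using C_0_Y_vanishes_off_Hat[OF F] by blast
  moreover have "Coz X ?f \<subseteq> \<Union>C"
  proof
    fix x assume "x \<in> Coz X ?f"
    then have x: "x \<in> topspace X" "F (e x) \<noteq> 0" unfolding Coz_def by auto
    then have "e x \<in> Hat C" using C(3) by blast
    then show "x \<in> \<Union>C" using e_in_Hat_iff[OF C(2) x(1)] by blast
  qed
  ultimately show ?thesis unfolding C_countable_def by blast
qed

lemma C_0_Y_eqI:
  fixes F G :: "'b \<Rightarrow> 'k::real_normed_field"
  assumes F: "F \<in> C_0 Y" and G: "G \<in> C_0 Y" and eq: "\<And>x. x \<in> topspace X \<Longrightarrow> F (e x) = G (e x)"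
  shows "F = G"
proof
  fix y show "F y = G y"
  proof (cases "y \<in> topspace Y")
    case True
    have "norm (F y - G y) \<le> 0"
      by (rule norm_le_on_Y[OF C_b_continuous[OF C_b_diff] _ True]) (use F G eq C_0_subset_C_b in auto)
    then show ?thesis by simp
  next
    case False
    then show ?thesis using C_b_outside C_0_subset_C_b F G by metis
  qed
qed

text \<open>The isomorphism sends \<open>f\<close> to its extension, which is unique because the image of \<open>X\<close> is dense. Density
also gives the equality of norms, and uniqueness makes the map multiplicative and linear.\<close>

lemma C_countable_isomorphic_C_0_Y:
  "isometrically_isomorphic (fun_alg X (C_countable :: ('a \<Rightarrow> 'k::{real_normed_field,euclidean_space}) set))
     (fun_alg Y (C_0 Y))"
proof -
  define \<phi> :: "('a \<Rightarrow> 'k) \<Rightarrow> 'b \<Rightarrow> 'k"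
    where "\<phi> = (\<lambda>f. SOME F. F \<in> C_0 Y \<and> (\<forall>x\<in>topspace X. F (e x) = f x))"
  have \<phi>: "\<phi> f \<in> C_0 Y \<and> (\<forall>x\<in>topspace X. \<phi> f (e x) = f x)" if "f \<in> C_countable" for f
    unfolding \<phi>_def using C_countable_extends[OF that] unfolding Bex_def by (rule someI_ex)
  have \<phi>_eq: "\<phi> f = F" if "F \<in> C_0 Y" "\<And>x. x \<in> topspace X \<Longrightarrow> F (e x) = f x" for F f
  proof -
    have "\<exists>F. F \<in> C_0 Y \<and> (\<forall>x\<in>topspace X. F (e x) = f x)" using that by blast
    then have "\<phi> f \<in> C_0 Y \<and> (\<forall>x\<in>topspace X. \<phi> f (e x) = f x)"
      unfolding \<phi>_def by (rule someI_ex)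
    then show ?thesis using that by (intro C_0_Y_eqI) auto
  qed
  have outside: "f x = 0" if "f \<in> C_countable" "x \<notin> topspace X" for f :: "'a \<Rightarrow> 'k" and x
    using C_b_outside[where f = f, OF _ that(2)] that(1) unfolding C_countable_def by blast
  have "bij_betw \<phi> C_countable (C_0 Y)"
  proof (rule bij_betwI[where g = "\<lambda>F x. if x \<in> topspace X then F (e x) else 0"])
    show "\<phi> \<in> C_countable \<rightarrow> C_0 Y" using \<phi> by blast
    show "(\<lambda>F x. if x \<in> topspace X then F (e x) else 0) \<in> C_0 Y \<rightarrow> C_countable"
      using C_0_Y_restricts by blast
    show "(\<lambda>x. if x \<in> topspace X then \<phi> f (e x) else 0) = f" if "f \<in> C_countable" for f
    proof
      show "(if x \<in> topspace X then \<phi> f (e x) else 0) = f x" for x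
        using \<phi>[OF that] outside[OF that, of x] by simp
    qed
    show "\<phi> (\<lambda>x. if x \<in> topspace X then F (e x) else 0) = F" if "F \<in> C_0 Y" for F
      by (rule \<phi>_eq[OF that]) simp
  qed
  moreover have "\<phi> (\<lambda>x. f x + g x) = (\<lambda>y. \<phi> f y + \<phi> g y)"
    if "f \<in> C_countable" "g \<in> C_countable" for f g
    using \<phi>[OF that(1)] \<phi>[OF that(2)] by (intro \<phi>_eq C_0_add) auto
  moreover have "\<phi> (\<lambda>x. f x * g x) = (\<lambda>y. \<phi> f y * \<phi> g y)"
    if "f \<in> C_countable" "g \<in> C_countable" for f g
    using \<phi>[OF that(1)] \<phi>[OF that(2)] by (intro \<phi>_eq C_0_mult C_0_subset_C_b) auto
  moreover have "\<phi> (\<lambda>x. c * f x) = (\<lambda>y. c * \<phi> f y)" if "f \<in> C_countable" for c f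
    using \<phi>[OF that] by (intro \<phi>_eq C_0_scale) auto
  moreover have "sup_norm Y (\<phi> f) = sup_norm X f" if f: "f \<in> C_countable" for f
  proof (rule antisym)
    have fb: "f \<in> C_b X" using f unfolding C_countable_def by blast
    have Fb: "\<phi> f \<in> C_b Y" using \<phi>[OF f] C_0_subset_C_b by blast
    show "sup_norm Y (\<phi> f) \<le> sup_norm X f"
    proof (rule sup_norm_le[OF sup_norm_nonneg[OF fb]])
      show "norm (\<phi> f y) \<le> sup_norm X f" if "y \<in> topspace Y" for y
        using norm_le_on_Y[OF C_b_continuous[OF Fb] _ that] \<phi>[OF f] norm_le_sup_norm[OF fb] by simp
    qed
    show "sup_norm X f \<le> sup_norm Y (\<phi> f)"
    proof (rule sup_norm_le[OF sup_norm_nonneg[OF Fb]])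
      show "norm (f x) \<le> sup_norm Y (\<phi> f)" if "x \<in> topspace X" for x
        using norm_le_sup_norm[OF Fb, of "e x"] \<phi>[OF f] that by simp
    qed
  qed
  ultimately show ?thesis
    unfolding isometrically_isomorphic_def fun_alg_def by (intro exI[of _ \<phi>]) simp
qed

text \<open>A separable cozero set meets only countably many pieces, and a countable union of separable pieces is
separable.\<close>

lemma C_countable_eq_C_s:
  assumes met: "metrizable_space X" and sep: "\<And>U. U \<in> \<P> \<Longrightarrow> separable_in X U"
  shows "(C_countable :: ('a \<Rightarrow> 'k::real_normed_field) set) = C_s X"
proof (intro equalityI subsetI)
  fix f :: "'a \<Rightarrow> 'k" assume "f \<in> C_countable"
  then obtain C where f: "f \<in> C_b X" and C: "countable C" "C \<subseteq> \<P>" "Coz X f \<subseteq> \<Union>C"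
    unfolding C_countable_def by blast
  have "separable_in X (\<Union>U\<in>C. U)"
    using C(1) by (rule separable_in_countable_UN) (use C(2) sep in blast)
  then show "f \<in> C_s X"
    unfolding C_s_iff[OF met] using f C(3) by (auto intro: separable_in_subset)
next
  fix f :: "'a \<Rightarrow> 'k" assume "f \<in> C_s X"
  then have f: "f \<in> C_b X" "separable_in X (Coz X f)" unfolding C_s_iff[OF met] by auto
  let ?C = "{U \<in> \<P>. U \<inter> Coz X f \<noteq> {}}"
  have "countable ?C"
    using countable_partition_members_meeting_separable[OF disjoint_pieces open_pieces f(2)] by blast
  moreover have "Coz X f \<subseteq> \<Union>?C"
    using Union_pieces unfolding Coz_def by blast
  ultimately show "f \<in> C_countable" unfolding C_countable_def using f(1) by blast
qed

end

section \<open>Coherent families of finite-to-one functions\<close>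

text \<open>A well-order of type \<open>\<omega>\<^sub>1\<close>, given by the two properties that characterise it.\<close>

locale omega_one_order =
  fixes r :: "'w rel"
  assumes Well_order: "Well_order r"
    and uncountable_Field: "\<not> countable (Field r)"
    and countable_under: "a \<in> Field r \<Longrightarrow> countable (under r a)"
begin

lemma refl: "a \<in> Field r \<Longrightarrow> (a, a) \<in> r"
  using Well_order unfolding order_on_defs refl_on_def by blast

lemma trans: "(a, b) \<in> r \<Longrightarrow> (b, c) \<in> r \<Longrightarrow> (a, c) \<in> r"
  using Well_order unfolding order_on_defs by (meson transD)

lemma total: "a \<in> Field r \<Longrightarrow> b \<in> Field r \<Longrightarrow> (a, b) \<in> r \<or> (b, a) \<in> r"
  using Well_order refl unfolding order_on_defs total_on_def by metis

lemma antisym: "(a, b) \<in> r \<Longrightarrow> (b, a) \<in> r \<Longrightarrow> a = b"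
  using Well_order unfolding order_on_defs antisym_def by blast

lemma Field1: "(a, b) \<in> r \<Longrightarrow> a \<in> Field r"
  by (auto simp: Field_def)

text \<open>Otherwise the initial segments below the elements of \<open>C\<close> would cover the uncountable field.\<close>

lemma countable_bounded:
  assumes "countable C" "C \<subseteq> Field r"
  shows "\<exists>a\<in>Field r. C \<subseteq> under r a"
proof (rule ccontr)
  assume none: "\<not> ?thesis"
  have "Field r \<subseteq> (\<Union>c\<in>C. under r c)"
  proof
    fix a assume a: "a \<in> Field r"
    then obtain c where c: "c \<in> C" "(c, a) \<notin> r"
      using none unfolding under_def by blast
    then have "(a, c) \<in> r" using total[OF a, of c] assms(2) by blast
    then show "a \<in> (\<Union>c\<in>C. under r c)" using c unfolding under_def by blast
  qed
  moreover have "countable (\<Union>c\<in>C. under r c)"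
    using assms countable_under by (intro countable_UN) auto
  ultimately show False using uncountable_Field countable_subset by blast
qed

text \<open>Choose a weakly increasing sequence \<open>b 0, b 1, \<dots>\<close> cofinal below \<open>a\<close>, and let \<open>N x\<close> be the first index \<open>n\<close>
with \<open>x \<le> b n\<close>. Put \<open>g x = max (f (b (N x)) x) (N x)\<close>. The second argument keeps the fibres of \<open>g\<close>
inside single segments \<open>{x. x \<le> b k}\<close>. It disturbs only finitely many values on each segment, because
\<open>f (b n)\<close> is finite-to-one. Repetitions in the sequence are harmless, so successors and limits need no
separate treatment.\<close>

lemma extend_coherent_family:
  fixes f :: "'w \<Rightarrow> 'w \<Rightarrow> nat"
  assumes a: "a \<in> Field r"
    and fto: "\<And>b n. b \<in> underS r a \<Longrightarrow> finite {x \<in> under r b. f b x = n}"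
    and coh: "\<And>b c. b \<in> underS r a \<Longrightarrow> c \<in> underS r b \<Longrightarrow> finite {x \<in> under r c. f b x \<noteq> f c x}"
  shows "\<exists>g. (\<forall>n. finite {x \<in> under r a. g x = n}) \<and>
    (\<forall>b\<in>underS r a. finite {x \<in> under r b. g x \<noteq> f b x})"
proof (cases "underS r a = {}")
  case True
  then have sub: "under r a \<subseteq> {a}" unfolding under_def underS_def by blast
  have "finite {x \<in> under r a. (0::nat) = n}" for n
    by (rule finite_subset[of _ "{a}"]) (use sub in auto)
  then show ?thesis using True by (intro exI[of _ "\<lambda>x. 0"]) simp
next
  case False
  have "underS r a \<subseteq> under r a" unfolding under_def underS_def by blast
  then have "countable (underS r a)" using countable_under[OF a] countable_subset by blast
  then obtain c :: "nat \<Rightarrow> 'w" where c: "range c = underS r a"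
    using False uncountable_def by blast
  \<comment> \<open>The running maximum of the enumeration \<open>c\<close>.\<close>
  define b where "b = rec_nat (c 0) (\<lambda>n x. if (x, c (Suc n)) \<in> r then c (Suc n) else x)"
  have b0: "b 0 = c 0" and bS: "b (Suc n) = (if (b n, c (Suc n)) \<in> r then c (Suc n) else b n)" for n
    unfolding b_def by simp_all
  have bin: "b n \<in> underS r a" for n
    by (induction n) (use c in \<open>auto simp: b0 bS\<close>)
  have below: "x \<in> Field r" if "x \<in> underS r a" for x
    using that Field1 unfolding underS_def by blast
  have cb: "(c n, b n) \<in> r" for n
  proof (cases n)
    case 0
    then show ?thesis using refl[OF below[OF bin[of 0]]] b0 by simp
  next
    case (Suc m)
    show ?thesis
      using total[OF below[OF bin[of m]] below, of "c n"] refl[OF below, of "c n"] c bS[of m] Suc by auto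
  qed
  have bSuc: "(b n, b (Suc n)) \<in> r" for n
    using refl[OF below[OF bin[of n]]] by (simp add: bS)
  have bmono: "(b n, b m) \<in> r" if "n \<le> m" for n m
    using that
  proof (induction m rule: dec_induct)
    case base show ?case by (rule refl[OF below[OF bin]])
  next
    case (step m) then show ?case using trans bSuc by blast
  qed
  have covers: "\<exists>n. (x, b n) \<in> r" if "x \<in> underS r a" for x
    using that cb unfolding c[symmetric] by blast
  define N where "N = (\<lambda>x. LEAST n. (x, b n) \<in> r)"
  have N: "(x, b (N x)) \<in> r" if "x \<in> underS r a" for x
    unfolding N_def using covers[OF that] by (rule LeastI_ex)
  have Nle: "N x \<le> n" if "(x, b n) \<in> r" for x n
    unfolding N_def using that by (rule Least_le)
  define g where "g = (\<lambda>x. if x = a then 0 else max (f (b (N x)) x) (N x))"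
  have under_b: "x \<in> underS r a" if "x \<in> under r (b n)" for x n
  proof -
    have "(x, b n) \<in> r" "(b n, a) \<in> r" "b n \<noteq> a"
      using that bin[of n] unfolding under_def underS_def by auto
    then show ?thesis using trans antisym unfolding underS_def by blast
  qed
  have coh': "finite {x \<in> under r d. f b' x \<noteq> f d x}" if "b' \<in> underS r a" "(d, b') \<in> r" for b' d
    using coh[OF that(1), of d] that(2) unfolding underS_def by (cases "d = b'") auto
  have gb: "finite {x \<in> under r (b m). g x \<noteq> f (b m) x}" for m
  proof (rule finite_subset)
    show "{x \<in> under r (b m). g x \<noteq> f (b m) x} \<subseteq>
      (\<Union>n\<in>{..m}. (\<Union>k\<in>{..<n}. {x \<in> under r (b n). f (b n) x = k}) \<union> {x \<in> under r (b n). f (b m) x \<noteq> f (b n) x})"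
    proof
      fix x assume x: "x \<in> {x \<in> under r (b m). g x \<noteq> f (b m) x}"
      then have xa: "x \<in> underS r a" using under_b by blast
      then have "x \<noteq> a" unfolding underS_def by blast
      have "N x \<le> m" using x Nle unfolding under_def by blast
      moreover have xN: "x \<in> under r (b (N x))" using N[OF xa] unfolding under_def by blast
      moreover have "f (b (N x)) x < N x \<or> f (b m) x \<noteq> f (b (N x)) x"
        using x \<open>x \<noteq> a\<close> unfolding g_def by auto
      ultimately show "x \<in> (\<Union>n\<in>{..m}. (\<Union>k\<in>{..<n}. {x \<in> under r (b n). f (b n) x = k}) \<union>
          {x \<in> under r (b n). f (b m) x \<noteq> f (b n) x})"
        by blast
    qed
    show "finite (\<Union>n\<in>{..m}. (\<Union>k\<in>{..<n}. {x \<in> under r (b n). f (b n) x = k}) \<union>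
          {x \<in> under r (b n). f (b m) x \<noteq> f (b n) x})"
      using fto[OF bin] coh'[OF bin bmono] by (intro finite_UN_I finite_UnI) auto
  qed
  have "finite {x \<in> under r a. g x = k}" for k
  proof (rule finite_subset)
    show "{x \<in> under r a. g x = k} \<subseteq>
      {a} \<union> {x \<in> under r (b k). f (b k) x = k} \<union> {x \<in> under r (b k). g x \<noteq> f (b k) x}"
    proof
      fix x assume x: "x \<in> {x \<in> under r a. g x = k}"
      show "x \<in> {a} \<union> {x \<in> under r (b k). f (b k) x = k} \<union> {x \<in> under r (b k). g x \<noteq> f (b k) x}"
      proof (cases "x = a")
        case False
        then have xa: "x \<in> underS r a" using x unfolding under_def underS_def by blast
        have "N x \<le> k" using x False unfolding g_def by auto
        then have "(x, b k) \<in> r" using N[OF xa] bmono trans by blast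
        then show ?thesis using x unfolding under_def by auto
      qed simp
    qed
    show "finite ({a} \<union> {x \<in> under r (b k). f (b k) x = k} \<union> {x \<in> under r (b k). g x \<noteq> f (b k) x})"
      using fto[OF bin] gb by simp
  qed
  moreover have "finite {x \<in> under r d. g x \<noteq> f d x}" if d: "d \<in> underS r a" for d
  proof -
    obtain m where m: "(d, b m) \<in> r" using covers[OF d] by blast
    have "{x \<in> under r d. g x \<noteq> f d x} \<subseteq>
        {x \<in> under r (b m). g x \<noteq> f (b m) x} \<union> {x \<in> under r d. f (b m) x \<noteq> f d x}"
      using trans[OF _ m] unfolding under_def by auto
    then show ?thesis using gb coh'[OF bin m] finite_subset by blast
  qed
  ultimately show ?thesis by blast
qed

text \<open>Well-founded recursion along \<open>r\<close>, each step being an instance of \<open>extend_coherent_family\<close>.\<close>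

lemma coherent_finite_to_one_family:
  obtains f :: "'w \<Rightarrow> 'w \<Rightarrow> nat" where
    "\<And>a n. a \<in> Field r \<Longrightarrow> finite {x \<in> under r a. f a x = n}"
    "\<And>a b. a \<in> Field r \<Longrightarrow> b \<in> under r a \<Longrightarrow> finite {x \<in> under r b. f a x \<noteq> f b x}"
proof -
  define P where "P = (\<lambda>(f :: 'w \<Rightarrow> 'w \<Rightarrow> nat) a g. a \<in> Field r \<longrightarrow>
    (\<forall>n. finite {x \<in> under r a. g x = n}) \<and> (\<forall>b\<in>underS r a. finite {x \<in> under r b. g x \<noteq> f b x}))"
  have "\<exists>f. \<forall>a. P f a (f a)"
  proof (rule dependent_wf_choice[where R = "r - Id"])
    show "wf (r - Id)" using Well_order unfolding order_on_defs by blast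
    show "P f a g = P f' a g" if "\<And>z. (z, a) \<in> r - Id \<Longrightarrow> f z = f' z" for f f' a g
    proof -
      have "f b = f' b" if "b \<in> underS r a" for b
        using that \<open>\<And>z. (z, a) \<in> r - Id \<Longrightarrow> f z = f' z\<close> unfolding underS_def by blast
      then show ?thesis unfolding P_def by simp
    qed
    show "\<exists>g. P f a g" if IH: "\<And>b. (b, a) \<in> r - Id \<Longrightarrow> P f b (f b)" for a f
    proof (cases "a \<in> Field r")
      case True
      have b: "P f b (f b)" "b \<in> Field r" if "b \<in> underS r a" for b
        using IH[of b] Field1[of b a] that unfolding underS_def by auto
      have "\<exists>g. (\<forall>n. finite {x \<in> under r a. g x = n}) \<and>
          (\<forall>b\<in>underS r a. finite {x \<in> under r b. g x \<noteq> f b x})"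
        by (rule extend_coherent_family[OF True]) (use b in \<open>auto simp: P_def\<close>)
      then show ?thesis unfolding P_def by blast
    qed (simp add: P_def)
  qed
  then obtain f where f: "\<And>a. P f a (f a)" by blast
  show thesis
  proof (rule that[of f])
    show "finite {x \<in> under r a. f a x = n}" if "a \<in> Field r" for a n
      using f[of a] that unfolding P_def by blast
    show "finite {x \<in> under r b. f a x \<noteq> f b x}" if "a \<in> Field r" "b \<in> under r a" for a b
    proof (cases "a = b")
      case False
      then have "b \<in> underS r a" using that(2) unfolding under_def underS_def by blast
      then show ?thesis using f[of a] that(1) unfolding P_def by blast
    qed simp
  qed
qed

text \<open>Some fibre of \<open>F\<close> is uncountable. A countably infinite part of it is bounded by some \<open>a\<close>, and if \<open>F\<close>
agreed with \<open>f a\<close> up to finitely many points, then \<open>f a\<close> would have an infinite fibre.\<close>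

lemma coherent_family_not_uniform:
  fixes f :: "'w \<Rightarrow> 'w \<Rightarrow> nat"
  assumes fto: "\<And>a n. a \<in> Field r \<Longrightarrow> finite {x \<in> under r a. f a x = n}"
  shows "\<exists>a\<in>Field r. infinite {x \<in> under r a. F x \<noteq> f a x}"
proof (rule ccontr)
  assume contra: "\<not> ?thesis"
  have "Field r = (\<Union>n. {x \<in> Field r. F x = n})" by blast
  then obtain n where "\<not> countable {x \<in> Field r. F x = n}"
    using uncountable_Field countable_UN[of UNIV "\<lambda>n. {x \<in> Field r. F x = n}"] by auto
  then have "infinite {x \<in> Field r. F x = n}" using countable_finite by blast
  then obtain D where D: "D \<subseteq> {x \<in> Field r. F x = n}" "countable D" "infinite D"
    using infinite_countable_subset' by blast
  have "D \<subseteq> Field r" using D(1) by blast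
  then obtain a where a: "a \<in> Field r" "D \<subseteq> under r a"
    using countable_bounded[OF D(2)] by blast
  have "D \<subseteq> {x \<in> under r a. f a x = n} \<union> {x \<in> under r a. F x \<noteq> f a x}"
    using D(1) a(2) by auto
  moreover have "finite ({x \<in> under r a. f a x = n} \<union> {x \<in> under r a. F x \<noteq> f a x})"
    using fto[OF a(1)] contra a(1) by simp
  ultimately show False using D(3) finite_subset by blast
qed

end

text \<open>The successor cardinal of \<open>\<aleph>\<^sub>0\<close> is a well-order whose proper initial segments are countable. It
embeds into every uncountable set, and so does its product with \<open>\<nat>\<close>, which has the same cardinality.\<close>

lemma omega_one_order_exists:
  includes cardinal_syntax
  assumes "\<not> countable A"
  obtains r :: "nat set rel" and \<iota> :: "nat set \<times> nat \<Rightarrow> 'p"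
  where "omega_one_order r" "inj_on \<iota> (Field r \<times> UNIV)" "\<iota> ` (Field r \<times> UNIV) \<subseteq> A"
proof -
  define r where "r = cardSuc natLeq"
  have card: "Card_order r"
    unfolding r_def by (rule cardSuc_Card_order[OF natLeq_Card_order])
  have gt: "natLeq <o r" unfolding r_def by (rule cardSuc_greater[OF natLeq_Card_order])
  have Fr: "|Field r| =o r" by (rule card_of_Field_ordIso[OF card])
  have small: "countable S" if "|S| <o r" for S :: "nat set set"
  proof -
    have "\<not> r \<le>o |S|" using that not_ordLess_ordLeq by blast
    then have "\<not> natLeq <o |S|"
      unfolding r_def using cardSuc_least[OF natLeq_Card_order card_of_Card_order] by blast
    then have "|S| \<le>o natLeq"
      using not_ordLeq_iff_ordLess card_of_Well_order natLeq_Well_order by blast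
    then show ?thesis by (simp add: countable_card_le_natLeq)
  qed
  have unc: "\<not> countable (Field r)"
  proof
    assume "countable (Field r)"
    then have "|Field r| \<le>o natLeq" by (simp add: countable_card_le_natLeq)
    then have "r \<le>o natLeq" using Fr ordIso_symmetric ordIso_ordLeq_trans by blast
    then show False using gt not_ordLess_ordLeq by blast
  qed
  have "omega_one_order r"
  proof
    show "Well_order r" using card card_order_on_well_order_on by blast
    show "\<not> countable (Field r)" by (rule unc)
    fix a assume a: "a \<in> Field r"
    have "countable (underS r a)" by (rule small[OF card_of_underS[OF card a]])
    moreover have "under r a \<subseteq> insert a (underS r a)" unfolding under_def underS_def by blast
    ultimately show "countable (under r a)" by (meson countable_insert countable_subset)
  qed
  moreover have "|Field r \<times> (UNIV :: nat set)| \<le>o |A|"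
  proof -
    have inf: "infinite (Field r)" using unc countable_finite by blast
    then have "|Field r \<times> (UNIV :: nat set)| =o |Field r|"
      by (intro card_of_Times_infinite_simps) (auto simp: infinite_iff_card_of_nat[symmetric])
    then have "|Field r \<times> (UNIV :: nat set)| =o r" using Fr by (rule ordIso_transitive)
    moreover have "natLeq <o |A|"
      using assms not_ordLeq_iff_ordLess card_of_Well_order natLeq_Well_order
      by (metis countable_card_le_natLeq)
    then have "r \<le>o |A|" unfolding r_def by (rule cardSuc_least[OF natLeq_Card_order card_of_Card_order])
    ultimately show ?thesis by (rule ordIso_ordLeq_trans)
  qed
  then obtain \<iota> where "inj_on \<iota> (Field r \<times> (UNIV :: nat set))" "\<iota> ` (Field r \<times> UNIV) \<subseteq> A"
    unfolding card_of_ordLeq[symmetric] by blast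
  ultimately show thesis by (rule that)
qed

section \<open>Failure of normality\<close>

context clopen_pieces
begin

text \<open>The points at infinity of \<open>Hat S\<close>, that is, those that stay in \<open>Hat\<close> when finitely many members of \<open>S\<close>
are removed. It depends only on \<open>S\<close> modulo finite sets.\<close>

definition star :: "'a set set \<Rightarrow> 'b set" where
  "star S = (\<Inter>F\<in>Collect finite. Hat (S - F))"

lemma star_subset_Hat: "star S \<subseteq> Hat (S - F)" if "finite F"
  unfolding star_def using that by blast

lemma star_mono_mod_finite:
  assumes "finite (S - T)" shows "star S \<subseteq> star T"
proof
  fix y assume y: "y \<in> star S"
  have "y \<in> Hat (T - F)" if "finite F" for F
  proof -
    have "y \<in> Hat (S - (F \<union> (S - T)))" using y star_subset_Hat[of "F \<union> (S - T)" S] that assms by blast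
    moreover have "S - (F \<union> (S - T)) \<subseteq> T - F" by blast
    ultimately show ?thesis using Hat_mono by blast
  qed
  then show "y \<in> star T" unfolding star_def by blast
qed

lemma star_disjoint:
  assumes "finite (S \<inter> T)" "S \<subseteq> \<P>" "T \<subseteq> \<P>"
  shows "star S \<inter> star T = {}"
proof -
  have "star S \<subseteq> Hat (S - (S \<inter> T))" "star T \<subseteq> Hat (T - {})"
    using star_subset_Hat assms(1) by blast+
  moreover have "Hat (S - (S \<inter> T)) \<inter> Hat (T - {}) = Hat ((S - (S \<inter> T)) \<inter> (T - {}))"
    using assms by (intro Hat_Int) auto
  moreover have "(S - (S \<inter> T)) \<inter> (T - {}) = {}" by blast
  ultimately show ?thesis by auto
qed

lemma Hat_Int_star:
  assumes "C \<subseteq> \<P>" "S \<subseteq> \<P>"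
  shows "Hat C \<inter> star S \<subseteq> star (C \<inter> S)"
proof
  fix y assume y: "y \<in> Hat C \<inter> star S"
  have "y \<in> Hat (C \<inter> S - F)" if "finite F" for F
  proof -
    have "y \<in> Hat C \<inter> Hat (S - F)" using y star_subset_Hat[OF that] by blast
    also have "\<dots> = Hat (C \<inter> (S - F))" using assms by (intro Hat_Int) auto
    also have "C \<inter> (S - F) = C \<inter> S - F" by blast
    finally show ?thesis .
  qed
  then show "y \<in> star (C \<inter> S)" unfolding star_def by blast
qed

lemma closedin_star: "closedin B (star S)"
  unfolding star_def by (intro closedin_INT closedin_Hat) auto

text \<open>Suppose infinitely many of the chosen points \<open>e (p P)\<close> lay outside \<open>U\<close>, and let \<open>T\<close> be the family of
their pieces. The compact set \<open>Hat T - U\<close> does not meet \<open>star T\<close>, so finitely many of the sets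
\<open>Hat (T - F)\<close> already have no common point in it. But any piece of \<open>T\<close> outside the finitely many
removed ones supplies such a point.\<close>

lemma star_in_open_imp_almost_all_points:
  assumes U: "openin B U" and star: "star S \<subseteq> U" and S: "S \<subseteq> \<P>"
    and p: "\<And>P. P \<in> S \<Longrightarrow> p P \<in> P"
  shows "finite {P \<in> S. e (p P) \<notin> U}"
proof (rule ccontr)
  define T where "T = {P \<in> S. e (p P) \<notin> U}"
  assume "infinite {P \<in> S. e (p P) \<notin> U}"
  then have inf: "infinite T" unfolding T_def .
  have TS: "T \<subseteq> S" "T \<subseteq> \<P>" unfolding T_def using S by auto
  have TU: "star T \<subseteq> U" using star_mono_mod_finite[of T S] TS star by (simp add: Diff_eq_empty_iff[THEN iffD2])
  define K where "K = Hat T - U"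
  have "closedin B K" unfolding K_def by (intro closedin_diff closedin_Hat U)
  then have K: "compactin B K" by (rule closedin_compact_space[OF compact])
  define \<U> where "\<U> = (\<lambda>F. topspace B - Hat (T - F)) ` Collect finite"
  have "openin B V" if "V \<in> \<U>" for V
    using that closedin_Hat unfolding \<U>_def by (auto intro: openin_diff)
  moreover have "K \<subseteq> \<Union>\<U>"
  proof
    fix y assume y: "y \<in> K"
    then have "y \<notin> star T" using TU unfolding K_def by blast
    moreover have "y \<in> topspace B" using y closedin_subset[OF \<open>closedin B K\<close>] by blast
    ultimately show "y \<in> \<Union>\<U>" unfolding star_def \<U>_def by blast
  qed
  ultimately obtain \<F> where F: "finite \<F>" "\<F> \<subseteq> \<U>" "K \<subseteq> \<Union>\<F>"
    using compactinD[OF K, of \<U>] by blast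
  obtain \<G> where "\<G> \<subseteq> Collect finite" "finite \<G>" "\<F> = (\<lambda>F. topspace B - Hat (T - F)) ` \<G>"
    using finite_subset_image[OF F(1) F(2)[unfolded \<U>_def]] by blast
  then have G: "finite \<G>" "\<G> \<subseteq> Collect finite" "K \<subseteq> (\<Union>F\<in>\<G>. topspace B - Hat (T - F))"
    using F(3) by simp_all
  have "finite (\<Union>\<G>)" using G by auto
  then have "infinite (T - \<Union>\<G>)" using inf by (rule Diff_infinite_finite)
  then obtain P where P: "P \<in> T" "P \<notin> \<Union>\<G>" using infinite_imp_nonempty by blast
  have pP: "p P \<in> P" using p P TS by blast
  have pX: "p P \<in> topspace X" using pP P TS Union_pieces by blast
  have H: "e (p P) \<in> Hat (T - F)" if "F \<subseteq> \<Union>\<G>" for F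
    using e_in_Hat_iff[of "T - F" "p P"] pX pP P TS that by blast
  have "e (p P) \<in> K" using H[of "{}"] P(1) unfolding K_def T_def by simp
  then obtain F where F: "F \<in> \<G>" "e (p P) \<notin> Hat (T - F)" using G(3) by blast
  then show False using H[of F] by blast
qed

text \<open>On the open set \<open>Hat C\<close> the union reduces, by coherence, to the part of a single closed set
\<open>star (S a)\<close>.\<close>

lemma closedin_Y_coherent_stars:
  assumes S: "\<And>a. a \<in> W \<Longrightarrow> S a \<subseteq> \<P>" "\<And>a. a \<in> W \<Longrightarrow> countable (S a)"
    and coherent: "\<And>C. countable C \<Longrightarrow> C \<subseteq> \<P> \<Longrightarrow> \<exists>a\<in>W. \<forall>b\<in>W. finite (C \<inter> S b - S a)"
  shows "closedin Y (\<Union>a\<in>W. star (S a))"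
proof -
  have sub: "(\<Union>a\<in>W. star (S a)) \<subseteq> core"
  proof
    fix y assume "y \<in> (\<Union>a\<in>W. star (S a))"
    then obtain a where a: "a \<in> W" "y \<in> star (S a)" by blast
    then have "y \<in> Hat (S a)" using star_subset_Hat[of "{}" "S a"] by auto
    then show "y \<in> core" using Hat_subset_core[OF S(2)[OF a(1)] S(1)[OF a(1)]] by blast
  qed
  have "openin Y (topspace Y - (\<Union>a\<in>W. star (S a)))"
  proof (subst openin_subopen, intro ballI)
    fix y assume y: "y \<in> topspace Y - (\<Union>a\<in>W. star (S a))"
    then obtain C where C: "countable C" "C \<subseteq> \<P>" "y \<in> Hat C"
      unfolding topspace_Y core_def by blast
    obtain a where a: "a \<in> W" "\<And>b. b \<in> W \<Longrightarrow> finite (C \<inter> S b - S a)"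
      using coherent[OF C(1,2)] by blast
    have "openin B (Hat C - star (S a))"
      by (intro openin_diff openin_Hat C closedin_star)
    moreover have HC: "Hat C - star (S a) \<subseteq> core" using Hat_subset_core[OF C(1,2)] by blast
    ultimately have "openin Y (Hat C - star (S a))"
      unfolding Y_def by (simp add: openin_open_subtopology openin_core)
    moreover have "z \<notin> star (S b)" if "z \<in> Hat C - star (S a)" "b \<in> W" for z b
    proof
      assume "z \<in> star (S b)"
      then have "z \<in> star (C \<inter> S b)" using Hat_Int_star[OF C(2) S(1)[OF that(2)]] that(1) by blast
      then show False using star_mono_mod_finite[OF a(2)[OF that(2)]] that(1) by blast
    qed
    ultimately show "\<exists>T. openin Y T \<and> y \<in> T \<and> T \<subseteq> topspace Y - (\<Union>a\<in>W. star (S a))"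
      using HC y C(3) a(1) unfolding topspace_Y by (intro exI[of _ "Hat C - star (S a)"]) blast
  qed
  then show ?thesis using sub by (simp add: closedin_def topspace_Y)
qed

text \<open>The family \<open>L a\<close> consists of the pieces with index below the graph of \<open>f a\<close>, the family \<open>M a\<close> of those
on or above it, and the closed sets to be separated are the unions of \<open>star (L a)\<close> and of \<open>star (M a)\<close>.
From an open set containing the first union and disjoint from a neighbourhood of the second, \<open>F\<close> reads
off the least height at which a representative point leaves the open set.\<close>

lemma not_normal_Y:
  assumes unc: "\<not> countable \<P>" and nonempty: "{} \<notin> \<P>"
  shows "\<not> normal_space Y"
proof
  assume normal: "normal_space Y"
  obtain r :: "nat set rel" and \<iota> :: "nat set \<times> nat \<Rightarrow> 'a set"
    where "omega_one_order r" and inj: "inj_on \<iota> (Field r \<times> UNIV)" and range: "\<iota> ` (Field r \<times> UNIV) \<subseteq> \<P>"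
    by (rule omega_one_order_exists[OF unc])
  interpret omega_one_order r by fact
  obtain f :: "nat set \<Rightarrow> nat set \<Rightarrow> nat" where
    fto: "\<And>a n. a \<in> Field r \<Longrightarrow> finite {x \<in> under r a. f a x = n}" and
    coh: "\<And>a b. a \<in> Field r \<Longrightarrow> b \<in> under r a \<Longrightarrow> finite {x \<in> under r b. f a x \<noteq> f b x}"
    by (rule coherent_finite_to_one_family) blast
  have under_Field: "under r a \<subseteq> Field r" for a
    unfolding under_def using Field1 by blast
  have \<iota>_eq: "\<iota> z = \<iota> w \<longleftrightarrow> z = w" if "z \<in> Field r \<times> UNIV" "w \<in> Field r \<times> UNIV" for z w
    using inj that by (rule inj_on_eq_iff)
  have coh_sym: "finite {x \<in> under r a \<inter> under r b. f a x \<noteq> f b x}" if ab: "a \<in> Field r" "b \<in> Field r" for a b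
  proof -
    have "(a, b) \<in> r \<or> (b, a) \<in> r" using ab by (rule total)
    then have "finite {x \<in> under r a. f b x \<noteq> f a x} \<or> finite {x \<in> under r b. f a x \<noteq> f b x}"
      using coh ab unfolding under_def by blast
    then show ?thesis
    proof
      assume "finite {x \<in> under r a. f b x \<noteq> f a x}"
      then show ?thesis by (rule rev_finite_subset) auto
    next
      assume "finite {x \<in> under r b. f a x \<noteq> f b x}"
      then show ?thesis by (rule rev_finite_subset) auto
    qed
  qed
  define L where "L = (\<lambda>a. \<iota> ` {(x, n). x \<in> under r a \<and> n < f a x})"
  define M where "M = (\<lambda>a. \<iota> ` {(x, n). x \<in> under r a \<and> f a x \<le> n})"
  have L_iff: "P \<in> L a \<longleftrightarrow> (\<exists>x n. P = \<iota> (x, n) \<and> x \<in> under r a \<and> n < f a x)" for P a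
    unfolding L_def by auto
  have M_iff: "P \<in> M a \<longleftrightarrow> (\<exists>x n. P = \<iota> (x, n) \<and> x \<in> under r a \<and> f a x \<le> n)" for P a
    unfolding M_def by auto
  have sub: "L a \<subseteq> \<P>" "M a \<subseteq> \<P>" for a
    unfolding L_def M_def using range under_Field[of a] by blast+
  have cnt: "countable (L a)" "countable (M a)" if "a \<in> Field r" for a
  proof -
    have "countable (under r a \<times> (UNIV :: nat set))" using countable_under[OF that] by simp
    then show "countable (L a)" "countable (M a)"
      unfolding L_def M_def by (auto intro!: countable_image elim!: countable_subset[rotated])
  qed
  have dis: "finite {(x, n). x \<in> under r a \<and> x \<in> under r b \<and> f a x \<le> n \<and> n < f b x}" (is "finite ?D")
    if ab: "a \<in> Field r" "b \<in> Field r" for a b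
  proof (rule finite_subset)
    let ?E = "{x \<in> under r a \<inter> under r b. f a x \<noteq> f b x}"
    show "?D \<subseteq> Sigma ?E (\<lambda>x. {..<f b x})" by auto
    show "finite (Sigma ?E (\<lambda>x. {..<f b x}))" using coh_sym[OF ab] by (intro finite_SigmaI) auto
  qed
  have LM: "finite (L a \<inter> M b)" if ab: "a \<in> Field r" "b \<in> Field r" for a b
  proof (rule finite_subset)
    show "L a \<inter> M b \<subseteq> \<iota> ` {(x, n). x \<in> under r b \<and> x \<in> under r a \<and> f b x \<le> n \<and> n < f a x}"
    proof
      fix P assume "P \<in> L a \<inter> M b"
      then have P: "P \<in> L a" "P \<in> M b" by blast+
      obtain x n where xn: "P = \<iota> (x, n)" "x \<in> under r a" "n < f a x"
        using P(1) unfolding L_iff by blast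
      obtain y m where ym: "P = \<iota> (y, m)" "y \<in> under r b" "f b y \<le> m"
        using P(2) unfolding M_iff by blast
      have "(x, n) = (y, m)" using \<iota>_eq[of "(x, n)" "(y, m)"] under_Field xn(1,2) ym(1,2) by auto
      then show "P \<in> \<iota> ` {(x, n). x \<in> under r b \<and> x \<in> under r a \<and> f b x \<le> n \<and> n < f a x}"
        using xn ym by auto
    qed
  qed (intro finite_imageI dis ab)
  have bound: "\<exists>a\<in>Field r. \<forall>x n. x \<in> Field r \<longrightarrow> \<iota> (x, n) \<in> C \<longrightarrow> x \<in> under r a"
    if C: "countable C" for C
  proof -
    have "countable {z \<in> Field r \<times> UNIV. \<iota> z \<in> C}"
      using countable_image_inj_Int_vimage[OF inj C] by (simp add: Int_def vimage_def)
    then have "countable (fst ` {z \<in> Field r \<times> UNIV. \<iota> z \<in> C})" by (rule countable_image)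
    moreover have "fst ` {z \<in> Field r \<times> UNIV. \<iota> z \<in> C} \<subseteq> Field r" by auto
    ultimately have "\<exists>a\<in>Field r. fst ` {z \<in> Field r \<times> UNIV. \<iota> z \<in> C} \<subseteq> under r a"
      by (rule countable_bounded)
    then obtain a where a: "a \<in> Field r" "fst ` {z \<in> Field r \<times> UNIV. \<iota> z \<in> C} \<subseteq> under r a" ..
    have "x \<in> under r a" if "x \<in> Field r" "\<iota> (x, n) \<in> C" for x n
    proof (rule subsetD[OF a(2)])
      show "x \<in> fst ` {z \<in> Field r \<times> UNIV. \<iota> z \<in> C}"
        using that by (intro image_eqI[of _ _ "(x, n)"]) auto
    qed
    then show ?thesis using a(1) by blast
  qed
  have "closedin Y (\<Union>a\<in>Field r. star (L a))"
  proof (rule closedin_Y_coherent_stars)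
    fix C assume C: "countable C" "C \<subseteq> \<P>"
    obtain a where a: "a \<in> Field r" "\<And>x n. x \<in> Field r \<Longrightarrow> \<iota> (x, n) \<in> C \<Longrightarrow> x \<in> under r a"
      using bound[OF C(1)] by blast
    have "finite (C \<inter> L b - L a)" if b: "b \<in> Field r" for b
    proof (rule finite_subset)
      show "C \<inter> L b - L a \<subseteq> \<iota> ` {(x, n). x \<in> under r a \<and> x \<in> under r b \<and> f a x \<le> n \<and> n < f b x}"
      proof
        fix P assume P: "P \<in> C \<inter> L b - L a"
        then have "P \<in> L b" by blast
        then obtain x n where xn: "P = \<iota> (x, n)" "x \<in> under r b" "n < f b x"
          unfolding L_iff by blast
        have xa: "x \<in> under r a" using a(2)[of x n] P xn under_Field by blast
        then have "f a x \<le> n" using P xn L_iff[of P a] not_less by blast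
        then show "P \<in> \<iota> ` {(x, n). x \<in> under r a \<and> x \<in> under r b \<and> f a x \<le> n \<and> n < f b x}"
          using xn xa by auto
      qed
    qed (intro finite_imageI dis a b)
    then show "\<exists>a\<in>Field r. \<forall>b\<in>Field r. finite (C \<inter> L b - L a)" using a(1) by blast
  qed (use sub cnt in auto)
  moreover have "closedin Y (\<Union>a\<in>Field r. star (M a))"
  proof (rule closedin_Y_coherent_stars)
    fix C assume C: "countable C" "C \<subseteq> \<P>"
    obtain a where a: "a \<in> Field r" "\<And>x n. x \<in> Field r \<Longrightarrow> \<iota> (x, n) \<in> C \<Longrightarrow> x \<in> under r a"
      using bound[OF C(1)] by blast
    have "finite (C \<inter> M b - M a)" if b: "b \<in> Field r" for b
    proof (rule finite_subset)
      show "C \<inter> M b - M a \<subseteq> \<iota> ` {(x, n). x \<in> under r b \<and> x \<in> under r a \<and> f b x \<le> n \<and> n < f a x}"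
      proof
        fix P assume P: "P \<in> C \<inter> M b - M a"
        then have "P \<in> M b" by blast
        then obtain x n where xn: "P = \<iota> (x, n)" "x \<in> under r b" "f b x \<le> n"
          unfolding M_iff by blast
        have xa: "x \<in> under r a" using a(2)[of x n] P xn under_Field by blast
        then have "n < f a x" using P xn M_iff[of P a] not_less by blast
        then show "P \<in> \<iota> ` {(x, n). x \<in> under r b \<and> x \<in> under r a \<and> f b x \<le> n \<and> n < f a x}"
          using xn xa by auto
      qed
    qed (intro finite_imageI dis a b)
    then show "\<exists>a\<in>Field r. \<forall>b\<in>Field r. finite (C \<inter> M b - M a)" using a(1) by blast
  qed (use sub cnt in auto)
  moreover have "disjnt (\<Union>a\<in>Field r. star (L a)) (\<Union>a\<in>Field r. star (M a))"
  proof -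
    have "star (L a) \<inter> star (M b) = {}" if "a \<in> Field r" "b \<in> Field r" for a b
      by (rule star_disjoint[OF LM[OF that] sub])
    then show ?thesis unfolding disjnt_def by blast
  qed
  ultimately obtain U V where UV: "openin Y U" "openin Y V"
    "(\<Union>a\<in>Field r. star (L a)) \<subseteq> U" "(\<Union>a\<in>Field r. star (M a)) \<subseteq> V" "disjnt U V"
    using normal unfolding normal_space_def by meson
  have UVB: "openin B U" "openin B V"
    using UV(1,2) openin_core unfolding Y_def by (auto simp: openin_open_subtopology)
  have "\<forall>P\<in>\<P>. \<exists>x. x \<in> P" using nonempty by (metis ex_in_conv)
  then obtain p where p: "\<And>P. P \<in> \<P> \<Longrightarrow> p P \<in> P" by metis
  \<comment> \<open>If no piece with index \<open>(x, n)\<close> has its representative on the wrong side, the representatives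
    lie in \<open>U\<close> exactly for \<open>n < f a x\<close>, so \<open>F x = f a x\<close>.\<close>
  define F where "F = (\<lambda>x. LEAST n. e (p (\<iota> (x, n))) \<notin> U)"
  have "finite {x \<in> under r a. F x \<noteq> f a x}" if a: "a \<in> Field r" for a
  proof -
    have bad1: "finite {P \<in> L a. e (p P) \<notin> U}"
      using UV(3) a sub(1) p by (intro star_in_open_imp_almost_all_points[OF UVB(1)]) blast+
    have "finite {P \<in> M a. e (p P) \<notin> V}"
      using UV(4) a sub(2) p by (intro star_in_open_imp_almost_all_points[OF UVB(2)]) blast+
    then have bad2: "finite {P \<in> M a. e (p P) \<in> U}"
      by (rule rev_finite_subset) (use UV(5) in \<open>auto simp: disjnt_def\<close>)
    define bad where "bad = {P \<in> L a. e (p P) \<notin> U} \<union> {P \<in> M a. e (p P) \<in> U}"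
    have "finite bad" unfolding bad_def using bad1 bad2 by simp
    then have "finite (\<iota> -` bad \<inter> Field r \<times> UNIV)" by (rule finite_vimage_IntI[OF _ inj])
    then have "finite (fst ` (\<iota> -` bad \<inter> Field r \<times> UNIV))" by (rule finite_imageI)
    moreover have "{x \<in> under r a. F x \<noteq> f a x} \<subseteq> fst ` (\<iota> -` bad \<inter> Field r \<times> UNIV)"
    proof
      fix x assume x: "x \<in> {x \<in> under r a. F x \<noteq> f a x}"
      have xF: "x \<in> Field r" using x under_Field by blast
      have "\<exists>n. \<iota> (x, n) \<in> bad"
      proof (rule ccontr)
        assume good: "\<not> ?thesis"
        have "e (p (\<iota> (x, n))) \<in> U" if "n < f a x" for n
        proof -
          have "\<iota> (x, n) \<in> L a" unfolding L_def using x that by blast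
          then show ?thesis using good unfolding bad_def by blast
        qed
        moreover have "e (p (\<iota> (x, f a x))) \<notin> U"
        proof -
          have "\<iota> (x, f a x) \<in> M a" unfolding M_def using x by blast
          then show ?thesis using good unfolding bad_def by blast
        qed
        ultimately have "F x = f a x"
          unfolding F_def by (intro Least_equality) (auto simp: not_less[symmetric])
        then show False using x by blast
      qed
      then obtain n where "\<iota> (x, n) \<in> bad" by blast
      then show "x \<in> fst ` (\<iota> -` bad \<inter> Field r \<times> UNIV)"
        using xF by (intro image_eqI[of _ _ "(x, n)"]) auto
    qed
    ultimately show ?thesis by (rule finite_subset[rotated])
  qed
  moreover have "\<exists>a\<in>Field r. infinite {x \<in> under r a. F x \<noteq> f a x}"
    by (rule coherent_family_not_uniform[OF fto])
  ultimately show False by blast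
qed

end

section \<open>The spectrum of the algebra of functions with separable support\<close>

lemma C_s_spectrum_exists:
  fixes X :: "'a topology"
  assumes met: "metrizable_space X" and sep: "locally_separable_space X"
  shows "\<exists>Y :: 'a set set topology. locally_compact_space Y \<and> Hausdorff_space Y \<and>
    isometrically_isomorphic (fun_alg X (C_s X :: ('a \<Rightarrow> 'k::{real_normed_field,euclidean_space}) set))
      (fun_alg Y (C_0 Y)) \<and>
    countably_compact_space Y \<and> (\<not> separable_space X \<longrightarrow> \<not> normal_space Y) \<and>
    (C_0 Y :: ('a set set \<Rightarrow> 'k) set) = C_00 Y"
proof -
  obtain \<P> where P: "\<Union>\<P> = topspace X" "disjoint \<P>"
    "\<And>U. U \<in> \<P> \<Longrightarrow> openin X U \<and> U \<noteq> {} \<and> separable_in X U"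
    by (rule separable_partition[OF met sep]) blast
  obtain B :: "'a set set topology" and e where "stone_cech X B e"
    using stone_cech_exists by blast
  then interpret clopen_pieces X B e \<P>
    by (rule clopen_pieces.intro) (unfold_locales, use P in auto)
  have eq: "C_countable = (C_s X :: ('a \<Rightarrow> 'k) set)"
    by (rule C_countable_eq_C_s[OF met]) (use P(3) in blast)
  have "\<not> normal_space Y" if "\<not> separable_space X"
  proof (rule not_normal_Y)
    show "{} \<notin> \<P>" using P(3) by blast
    show "\<not> countable \<P>"
    proof
      assume "countable \<P>"
      then have "separable_in X (\<Union>U\<in>\<P>. U)"
        by (rule separable_in_countable_UN) (use P(3) in blast)
      then have "separable_in X (topspace X)" using P(1) by simp
      then have "separable_space (subtopology X (topspace X))"
        using separable_space_subtopology_iff[OF met] by blast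
      then show False using that by simp
    qed
  qed
  then show ?thesis
    using locally_compact_Y Hausdorff_Y countably_compact_Y C_0_Y_eq_C_00
      C_countable_isomorphic_C_0_Y[where 'k = 'k] unfolding eq
    by (intro exI[of _ Y]) blast
qed

text \<open>The scalars are left general here, so that the real and the complex statement are two instances.\<close>

lemma C_s_spectrum:
  fixes X :: "'a topology"
  assumes met: "metrizable_space X" and sep: "locally_separable_space X"
  shows "banach_algebra (fun_alg X (C_s X :: ('a \<Rightarrow> 'k::{real_normed_field,euclidean_space}) set)) \<and>
     (\<exists>Y :: 'a set set topology.
        locally_compact_space Y \<and> Hausdorff_space Y \<and>
        isometrically_isomorphic (fun_alg X (C_s X :: ('a \<Rightarrow> 'k) set)) (fun_alg Y (C_0 Y)) \<and>
        countably_compact_space Y \<and>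
        (\<not> separable_space X \<longrightarrow> \<not> normal_space Y) \<and>
        (C_0 Y :: ('a set set \<Rightarrow> 'k) set) = C_00 Y) \<and>
     (\<forall>(Y :: 'y topology) (Z :: 'z topology).
        locally_compact_space Y \<and> Hausdorff_space Y \<and>
        isometrically_isomorphic (fun_alg X (C_s X :: ('a \<Rightarrow> 'k) set)) (fun_alg Y (C_0 Y)) \<and>
        locally_compact_space Z \<and> Hausdorff_space Z \<and>
        isometrically_isomorphic (fun_alg X (C_s X :: ('a \<Rightarrow> 'k) set)) (fun_alg Z (C_0 Z))
        \<longrightarrow> Y homeomorphic_space Z)"
  using banach_algebra_C_s[OF met] C_s_spectrum_exists[OF met sep, where 'k = 'k]
    homeomorphic_if_C_0_isomorphic[OF banach_algebra_C_s[OF met]]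
  by blast

theorem theorem2p10:
  fixes X :: "'a topology"
  assumes "metrizable_space X" and "locally_separable_space X"
  shows
    "(banach_algebra (fun_alg X (C_s X :: ('a \<Rightarrow> real) set)) \<and>
     (\<exists>Y :: 'a set set topology.
        locally_compact_space Y \<and> Hausdorff_space Y \<and>
        isometrically_isomorphic (fun_alg X (C_s X :: ('a \<Rightarrow> real) set)) (fun_alg Y (C_0 Y)) \<and>
        countably_compact_space Y \<and>
        (\<not> separable_space X \<longrightarrow> \<not> normal_space Y) \<and>
        (C_0 Y :: ('a set set \<Rightarrow> real) set) = C_00 Y) \<and>
     (\<forall>(Y :: 'y topology) (Z :: 'z topology).
        locally_compact_space Y \<and> Hausdorff_space Y \<and>
        isometrically_isomorphic (fun_alg X (C_s X :: ('a \<Rightarrow> real) set)) (fun_alg Y (C_0 Y)) \<and>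
        locally_compact_space Z \<and> Hausdorff_space Z \<and>
        isometrically_isomorphic (fun_alg X (C_s X :: ('a \<Rightarrow> real) set)) (fun_alg Z (C_0 Z))
        \<longrightarrow> Y homeomorphic_space Z)) \<and>
     (banach_algebra (fun_alg X (C_s X :: ('a \<Rightarrow> complex) set)) \<and>
     (\<exists>Y :: 'a set set topology.
        locally_compact_space Y \<and> Hausdorff_space Y \<and>
        isometrically_isomorphic (fun_alg X (C_s X :: ('a \<Rightarrow> complex) set)) (fun_alg Y (C_0 Y)) \<and>
        countably_compact_space Y \<and>
        (\<not> separable_space X \<longrightarrow> \<not> normal_space Y) \<and>
        (C_0 Y :: ('a set set \<Rightarrow> complex) set) = C_00 Y) \<and>
     (\<forall>(Y :: 'y topology) (Z :: 'z topology).
        locally_compact_space Y \<and> Hausdorff_space Y \<and>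
        isometrically_isomorphic (fun_alg X (C_s X :: ('a \<Rightarrow> complex) set)) (fun_alg Y (C_0 Y)) \<and>
        locally_compact_space Z \<and> Hausdorff_space Z \<and>
        isometrically_isomorphic (fun_alg X (C_s X :: ('a \<Rightarrow> complex) set)) (fun_alg Z (C_0 Z))
        \<longrightarrow> Y homeomorphic_space Z))"
  using C_s_spectrum[OF assms, where 'k = real] C_s_spectrum[OF assms, where 'k = complex]
  by (rule conjI)

end
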